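(* Let $1\le p\le\infty$, $n\in\mathbb N=\{0,1,2,\dots\}$, and let $\psi\in\mathscr M_{n,p}$. Then the spectrum of the multiplication operator $T_\psi$ on $H_n^p(\mathbb C^+)$ is $$\sigma(T_\psi)=\overline{\psi(\mathbb C^+)}.$$
   Context: $\mathbb C^+=\{z\in\mathbb C:\operatorname{Im} z>0\}$. For $1\le p<\infty$, $H^p(\mathbb C^+)$ is the space of holomorphic $F$ on $\mathbb C^+$ with $\|F\|_{H^p}=\sup_{y>0}\left(\int_{\mathbb R}|F(x+iy)|^p\,dx\right)^{1/p}<\infty$; $H^\infty(\mathbb C^+)$ is the space of bounded holomorphic functions with the sup norm. $H_n^p(\mathbb C^+)$ is the Banach space of holomorphic $F$ on $\mathbb C^+$ with $F^{(k)}\in H^p(\mathbb C^+)$ for $k=0,1,\dots,n$, with norm $\|F\|_{H_n^p}=\left(\sum_{k=0}^n\|F^{(k)}\|_{H^p}^p\right)^{1/p}$ if $1\le p<\infty$ and $\|F\|_{H_n^\infty}=\sum_{k=0}^n\|F^{(k)}\|_{H^\infty}$ if $p=\infty$. $\mathscr M_{n,p}$ is the multiplier space: the set of holomorphic $\psi$ on $\mathbb C^+$ with $\psi F\in H_n^p(\mathbb C^+)$ for all $F\in H_n^p(\mathbb C^+)$. For $\psi\in\mathscr M_{n,p}$, $T_\psi:H_n^p(\mathbb C^+)\to H_n^p(\mathbb C^+)$ is $T_\psi F=\psi F$ (a bounded operator). *)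

theory Defs
  imports "HOL-Complex_Analysis.Complex_Analysis"
begin

definition uhp :: "complex set" where
  "uhp = {z. Im z > 0}"

text \<open>
  A function on the upper half-plane is represented by its extension by zero to all of
  \<^typ>\<open>complex\<close>, so that two members of the spaces below are equal as HOL functions
  iff they agree on \<^const>\<open>uhp\<close>.  Accordingly, derivatives are again extended by zero.
\<close>

definition uhp_deriv :: "nat \<Rightarrow> (complex \<Rightarrow> complex) \<Rightarrow> complex \<Rightarrow> complex" where
  "uhp_deriv k F z = (if z \<in> uhp then (deriv ^^ k) F z else 0)"

text \<open>Power with the value infinity at infinity; only meant for exponents \<open>r > 0\<close>.\<close>

definition ennreal_powr :: "ennreal \<Rightarrow> real \<Rightarrow> ennreal" where
  "ennreal_powr x r = (if x = \<infinity> then \<infinity> else ennreal (enn2real x powr r))"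

text \<open>
  The norms take values in \<^typ>\<open>ennreal\<close> and are defined for all functions; the spaces consist of
  the holomorphic functions of finite norm.  The exponent \<open>p\<close> satisfies \<open>1 \<le> p \<le> \<infinity>\<close>.
\<close>

definition Hp_norm :: "ennreal \<Rightarrow> (complex \<Rightarrow> complex) \<Rightarrow> ennreal" where
  "Hp_norm p F =
     (if p = \<infinity> then (SUP z\<in>uhp. ennreal (cmod (F z)))
      else (SUP y\<in>{0<..}. ennreal_powr
              (\<integral>\<^sup>+ x. ennreal (cmod (F (Complex x y)) powr enn2real p) \<partial>lborel)
              (1 / enn2real p)))"

definition Hp :: "ennreal \<Rightarrow> (complex \<Rightarrow> complex) set" where
  "Hp p = {F. F holomorphic_on uhp \<and> (\<forall>z. z \<notin> uhp \<longrightarrow> F z = 0) \<and> Hp_norm p F < \<infinity>}"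

definition Hnp_norm :: "nat \<Rightarrow> ennreal \<Rightarrow> (complex \<Rightarrow> complex) \<Rightarrow> ennreal" where
  "Hnp_norm n p F =
     (if p = \<infinity> then (\<Sum>k\<le>n. Hp_norm p (uhp_deriv k F))
      else ennreal_powr (\<Sum>k\<le>n. ennreal_powr (Hp_norm p (uhp_deriv k F)) (enn2real p))
             (1 / enn2real p))"

definition Hnp :: "nat \<Rightarrow> ennreal \<Rightarrow> (complex \<Rightarrow> complex) set" where
  "Hnp n p = {F. F holomorphic_on uhp \<and> (\<forall>z. z \<notin> uhp \<longrightarrow> F z = 0) \<and>
                 (\<forall>k\<le>n. uhp_deriv k F \<in> Hp p)}"

definition mult_op :: "(complex \<Rightarrow> complex) \<Rightarrow> (complex \<Rightarrow> complex) \<Rightarrow> complex \<Rightarrow> complex" where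
  "mult_op \<psi> F = (\<lambda>z. \<psi> z * F z)"

text \<open>The values of a multiplier outside \<^const>\<open>uhp\<close> are irrelevant and left unconstrained.\<close>

definition multipliers :: "nat \<Rightarrow> ennreal \<Rightarrow> (complex \<Rightarrow> complex) set" where
  "multipliers n p =
     {\<psi>. \<psi> holomorphic_on uhp \<and> (\<forall>F\<in>Hnp n p. mult_op \<psi> F \<in> Hnp n p)}"

text \<open>
  Bounded linear operators and their spectrum on a normed space given by a carrier \<open>X\<close> of
  complex-valued functions, with pointwise operations, and a norm \<open>N\<close> that is finite on \<open>X\<close>.
  An operator is a function whose values outside \<open>X\<close> are irrelevant.
\<close>

definition bounded_operator_on ::
  "('a \<Rightarrow> complex) set \<Rightarrow> (('a \<Rightarrow> complex) \<Rightarrow> ennreal) \<Rightarrow>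
   (('a \<Rightarrow> complex) \<Rightarrow> ('a \<Rightarrow> complex)) \<Rightarrow> bool" where
  "bounded_operator_on X N S \<longleftrightarrow>
     (\<forall>F\<in>X. S F \<in> X) \<and>
     (\<forall>F\<in>X. \<forall>G\<in>X. S (\<lambda>z. F z + G z) = (\<lambda>z. S F z + S G z)) \<and>
     (\<forall>F\<in>X. \<forall>c. S (\<lambda>z. c * F z) = (\<lambda>z. c * S F z)) \<and>
     (\<exists>C::real. \<forall>F\<in>X. N (S F) \<le> ennreal C * N F)"

definition spectrum_on ::
  "('a \<Rightarrow> complex) set \<Rightarrow> (('a \<Rightarrow> complex) \<Rightarrow> ennreal) \<Rightarrow>
   (('a \<Rightarrow> complex) \<Rightarrow> ('a \<Rightarrow> complex)) \<Rightarrow> complex set" where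
  "spectrum_on X N T =
     {\<mu>. \<not> (\<exists>S. bounded_operator_on X N S \<and>
              (\<forall>F\<in>X. S (\<lambda>z. T F z - \<mu> * F z) = F) \<and>
              (\<forall>F\<in>X. (\<lambda>z. T (S F) z - \<mu> * S F z) = F))}"

end

theory Submission
  imports Defs "HOL-Probability.Sinc_Integral"
begin

text \<open>
  A point \<open>\<mu>\<close> lies outside the spectrum iff division by \<open>\<phi> = \<psi> - \<mu>\<close> is a bounded operator on
  \<^const>\<open>Hnp\<close>, so the theorem says that this happens exactly when \<open>\<phi>\<close> is bounded away from zero.

  If division by \<open>\<phi>\<close> is bounded with constant \<open>A\<close>, then \<open>F = \<phi>\<^sup>m (F / \<phi>\<^sup>m)\<close> and boundedness of the
  evaluation at \<open>w\<close> give \<open>\<bar>F w\<bar> \<le> const (A \<bar>\<phi> w\<bar>)\<^sup>m\<close> for every \<open>m\<close>.  Taking \<open>F w \<noteq> 0\<close> forces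
  \<open>\<bar>\<phi> w\<bar> \<ge> 1 / A\<close>, uniformly in \<open>w\<close> (\<open>in_spectrum_if_in_closure\<close>).

  Conversely let \<open>\<bar>\<phi>\<bar> \<ge> \<delta> > 0\<close>.  Differentiating \<open>F / \<phi>\<close> by the product rule produces powers of
  derivatives of \<open>\<phi>\<close>, about which nothing is known separately: it is only known that multiplication
  by powers of \<open>\<phi>\<close> preserves \<^const>\<open>Hnp\<close>.  This is enough, because at a fixed point \<open>z\<close>, with
  \<open>c = \<phi> z\<close>, the function \<open>1 / \<phi>\<close> agrees up to order \<open>n\<close> with a polynomial in \<open>\<phi>\<close>: the difference
  \<open>1 / \<phi> - (1 - (1 - \<phi> / c)\<^bsup>n+1\<^esup>) / \<phi>\<close> vanishes to order \<open>n + 1\<close> at \<open>z\<close>.  Hence the derivatives of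
  \<open>F / \<phi>\<close> of order \<open>k \<le> n\<close> are combinations of those of \<open>\<phi>\<^sup>i F\<close>, \<open>i \<le> n\<close>, with coefficients bounded
  by powers of \<open>1 / \<delta>\<close> (\<open>higher_deriv_divide\<close>), and so \<open>F / \<phi>\<close> is again in the space
  (\<open>Hnp_divide\<close>).

  For the norm bound one needs that multiplication by \<open>\<phi>\<close> is a bounded operator, which is a closed
  graph argument (\<open>mult_op_bounded\<close>): \<open>F \<mapsto> \<parallel>\<phi> F\<parallel>\<close> is a lower semicontinuous seminorm on a
  Banach space, hence bounded by Baire's theorem.  Both completeness and lower semicontinuity follow
  from the boundedness of point evaluations and Fatou's lemma.  Point evaluations are bounded by
  Cauchy's formula, averaged over horizontal translates of a circle (\<open>cmod_le_Hp_norm\<close>).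
\<close>

section \<open>The Hardy norm on horizontal lines\<close>

lemma open_uhp: "open uhp"
  unfolding uhp_def by (rule open_halfspace_Im_gt)

lemma slice_measurable:
  assumes "continuous_on uhp F" "y > 0"
  shows "(\<lambda>x. F (Complex x y)) \<in> borel_measurable borel"
proof -
  have "continuous_on UNIV (\<lambda>x. Complex x y)"
    unfolding Complex_eq by (intro continuous_intros)
  then have "continuous_on UNIV (\<lambda>x. F (Complex x y))"
    using assms by (intro continuous_on_compose2[OF assms(1)]) (auto simp: uhp_def)
  then show ?thesis by (rule borel_measurable_continuous_onI)
qed

lemma one_le_enn2real:
  assumes "1 \<le> p" "p \<noteq> \<infinity>"
  shows "1 \<le> enn2real p"
  using assms by (cases p) auto

lemma ennreal_powr_inverse_le_iff:
  assumes "q \<ge> 1" "c \<ge> 0"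
  shows "ennreal_powr I (1 / q) \<le> ennreal c \<longleftrightarrow> I \<le> ennreal (c powr q)"
proof (cases I)
  case (real r)
  have "r powr (1 / q) \<le> c \<longleftrightarrow> (r powr (1 / q)) powr q \<le> c powr q"
    using assms real powr_less_mono2[of q c "r powr (1 / q)"]
    by (auto simp: powr_mono2 not_le[symmetric])
  also have "(r powr (1 / q)) powr q = r"
    using assms real by (simp add: powr_powr)
  finally show ?thesis
    using real assms by (simp add: ennreal_powr_def)
qed (simp add: ennreal_powr_def top_unique)

text \<open>
  The Hardy norm is only ever used through its real upper bounds, which turn the supremum and the root
  into a bound for the integral on each line.
\<close>
lemma Hp_norm_le_iff:
  assumes "1 \<le> p" "p \<noteq> \<infinity>" "c \<ge> 0"
  shows "Hp_norm p F \<le> ennreal c \<longleftrightarrow>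
    (\<forall>y>0. (\<integral>\<^sup>+ x. ennreal (cmod (F (Complex x y)) powr enn2real p) \<partial>lborel)
            \<le> ennreal (c powr enn2real p))"
  using assms one_le_enn2real[OF assms(1,2)]
  by (simp add: Hp_norm_def SUP_le_iff ennreal_powr_inverse_le_iff Ball_def)

lemma Hp_norm_infinity_le_iff:
  assumes "c \<ge> 0"
  shows "Hp_norm \<infinity> F \<le> ennreal c \<longleftrightarrow> (\<forall>z\<in>uhp. cmod (F z) \<le> c)"
  using assms by (simp add: Hp_norm_def SUP_le_iff)

lemma Hp_norm_mono:
  assumes "1 \<le> p" "\<And>z. z \<in> uhp \<Longrightarrow> cmod (F z) \<le> cmod (G z)"
  shows "Hp_norm p F \<le> Hp_norm p G"
proof (cases "Hp_norm p G")
  case (real c)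
  show ?thesis
  proof (cases "p = \<infinity>")
    case True
    then show ?thesis using real Hp_norm_infinity_le_iff[of c F] Hp_norm_infinity_le_iff[of c G]
      assms(2) by (metis order.trans order_refl)
  next
    case False
    have "(\<integral>\<^sup>+ x. ennreal (cmod (F (Complex x y)) powr enn2real p) \<partial>lborel)
        \<le> ennreal (c powr enn2real p)" if "y > 0" for y
    proof -
      have "(\<integral>\<^sup>+ x. ennreal (cmod (F (Complex x y)) powr enn2real p) \<partial>lborel)
          \<le> (\<integral>\<^sup>+ x. ennreal (cmod (G (Complex x y)) powr enn2real p) \<partial>lborel)"
        using that by (intro nn_integral_mono ennreal_leI powr_mono2 assms(2)) (auto simp: uhp_def)
      also have "\<dots> \<le> ennreal (c powr enn2real p)"
        using Hp_norm_le_iff[OF assms(1) False, of c G] real that by auto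
      finally show ?thesis .
    qed
    then show ?thesis
      using Hp_norm_le_iff[OF assms(1) False, of c F] real by auto
  qed
qed simp

lemma Hp_norm_cmult_le:
  assumes "1 \<le> p" "continuous_on uhp F"
  shows "Hp_norm p (\<lambda>z. c * F z) \<le> ennreal (cmod c) * Hp_norm p F"
proof (cases "Hp_norm p F")
  case (real b)
  show ?thesis
  proof (cases "p = \<infinity>")
    case True
    then show ?thesis using real Hp_norm_infinity_le_iff[of "cmod c * b" "\<lambda>z. c * F z"]
      Hp_norm_infinity_le_iff[of b F] by (auto simp: ennreal_mult'' norm_mult mult_left_mono)
  next
    case False
    let ?q = "enn2real p"
    have "(\<integral>\<^sup>+ x. ennreal (cmod (c * F (Complex x y)) powr ?q) \<partial>lborel)
        \<le> ennreal ((cmod c * b) powr ?q)" if "y > 0" for y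
    proof -
      note [measurable] = slice_measurable[OF assms(2) that]
      have "(\<integral>\<^sup>+ x. ennreal (cmod (c * F (Complex x y)) powr ?q) \<partial>lborel)
          = ennreal (cmod c powr ?q) * (\<integral>\<^sup>+ x. ennreal (cmod (F (Complex x y)) powr ?q) \<partial>lborel)"
        by (simp add: norm_mult powr_mult ennreal_mult nn_integral_cmult)
      also have "\<dots> \<le> ennreal (cmod c powr ?q) * ennreal (b powr ?q)"
        using Hp_norm_le_iff[OF assms(1) False, of b F] real that by (intro mult_left_mono) auto
      finally show ?thesis using real by (simp add: powr_mult ennreal_mult)
    qed
    then show ?thesis
      using Hp_norm_le_iff[OF assms(1) False, of "cmod c * b" "\<lambda>z. c * F z"] real
      by (auto simp: ennreal_mult'')
  qed
next
  case top
  show ?thesis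
  proof (cases "c = 0")
    case True
    have "Hp_norm p (\<lambda>z. 0) \<le> ennreal 0"
    proof (cases "p = \<infinity>")
      case True then show ?thesis using Hp_norm_infinity_le_iff[of 0] by auto
    next
      case False then show ?thesis using Hp_norm_le_iff[OF assms(1) False, of 0] by auto
    qed
    then show ?thesis using True by simp
  qed (use top in \<open>simp add: ennreal_mult_top\<close>)
qed

lemma powr_convex_combination:
  fixes q :: real
  assumes q: "q \<ge> 1" and l: "l > 0" and m: "m > 0" and lm: "l + m = 1" and s: "s \<ge> 0" and t: "t \<ge> 0"
  shows "(l * s + m * t) powr q \<le> l * s powr q + m * t powr q"
proof -
  \<comment> \<open>\<open>powr_convex\<close> speaks about positive arguments; if \<open>s\<close> or \<open>t\<close> is zero, only \<open>k\<^sup>q \<le> k\<close> is left to use.\<close>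
  have shrink: "(k * x) powr q \<le> k * x powr q" if "0 < k" "k \<le> 1" "x \<ge> 0" for k x
  proof -
    have "k powr q \<le> k" using powr_mono'[of 1 q k] that q by auto
    then show ?thesis using that by (simp add: powr_mult mult_right_mono)
  qed
  consider "s = 0" | "t = 0" | "s > 0" "t > 0" using s t by linarith
  then show ?thesis
  proof cases
    case 3
    have l_eq: "1 - m = l" using lm by simp
    show ?thesis
      using convex_onD[OF powr_convex[OF q], of m s t] 3 m l l_eq by simp
  next
    case 1
    then show ?thesis using shrink[of m t] l m lm t by simp
  next
    case 2
    then show ?thesis using shrink[of l s] l m lm s by simp
  qed
qed

text \<open>
  The pointwise form of Minkowski's inequality: integrated with \<open>\<integral> u\<^sup>q \<le> a\<^sup>q\<close> and \<open>\<integral> v\<^sup>q \<le> b\<^sup>q\<close>, the right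
  side becomes \<open>(a + b)\<^bsup>q-1\<^esup> (a + b)\<close>.  It is convexity of \<open>x\<^sup>q\<close> at \<open>u / a\<close> and \<open>v / b\<close> with weights
  \<open>a / (a + b)\<close> and \<open>b / (a + b)\<close>.
\<close>
lemma powr_add_le_weighted:
  fixes q :: real
  assumes q: "q \<ge> 1" and a: "a > 0" and b: "b > 0" and u: "u \<ge> 0" and v: "v \<ge> 0"
  shows "(u + v) powr q \<le> (a + b) powr (q - 1) * (u powr q / a powr (q - 1) + v powr q / b powr (q - 1))"
proof -
  have split: "c powr q = c powr (q - 1) * c" if "c > 0" for c :: real
    using powr_add[of c "q - 1" 1] that by simp
  have "(u + v) powr q = ((a+b) * (a/(a+b) * (u/a) + b/(a+b) * (v/b))) powr q"
    using a b by (simp add: distrib_left)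
  also have "\<dots> = (a+b) powr q * (a/(a+b) * (u/a) + b/(a+b) * (v/b)) powr q"
    by (rule powr_mult)
  also have "\<dots> \<le> (a+b) powr q * (a/(a+b) * (u/a) powr q + b/(a+b) * (v/b) powr q)"
    using a b u v q by (intro mult_left_mono powr_convex_combination) (auto simp flip: add_divide_distrib)
  also have "\<dots> = (a + b) powr (q - 1) * (a * (u/a) powr q + b * (v/b) powr q)"
  proof -
    have "(a+b) * (a/(a+b) * x + b/(a+b) * y) = a * x + b * y" for x y
      using a b by (simp add: distrib_left)
    then show ?thesis
      using a b by (simp only: split[of "a+b"] mult.assoc add_pos_pos)
  qed
  also have "a * (u/a) powr q = u powr q / a powr (q - 1)"
    using a by (simp add: powr_divide split[of a])
  also have "b * (v/b) powr q = v powr q / b powr (q - 1)"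
    using b by (simp add: powr_divide split[of b])
  finally show ?thesis .
qed

lemma Hp_norm_add_le_real:
  assumes p: "1 \<le> p" and cont: "continuous_on uhp F" "continuous_on uhp G"
    and a: "a > 0" "Hp_norm p F \<le> ennreal a" and b: "b > 0" "Hp_norm p G \<le> ennreal b"
  shows "Hp_norm p (\<lambda>z. F z + G z) \<le> ennreal (a + b)"
proof (cases "p = \<infinity>")
  case True
  have "cmod (F z + G z) \<le> a + b" if "z \<in> uhp" for z
    using a b that Hp_norm_infinity_le_iff[of a F] Hp_norm_infinity_le_iff[of b G] True
    by (intro norm_triangle_mono) auto
  then show ?thesis
    using Hp_norm_infinity_le_iff[of "a + b" "\<lambda>z. F z + G z"] True a b by auto
next
  case False
  define q where "q = enn2real p"
  have q: "q \<ge> 1" using one_le_enn2real[OF p False] by (simp add: q_def)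
  have "(\<integral>\<^sup>+ x. ennreal (cmod (F (Complex x y) + G (Complex x y)) powr q) \<partial>lborel)
      \<le> ennreal ((a + b) powr q)" if y: "y > 0" for y
  proof -
    note [measurable] = slice_measurable[OF cont(1) y] slice_measurable[OF cont(2) y]
    let ?f = "\<lambda>x. cmod (F (Complex x y))" and ?g = "\<lambda>x. cmod (G (Complex x y))"
    have "(\<integral>\<^sup>+ x. ennreal (cmod (F (Complex x y) + G (Complex x y)) powr q) \<partial>lborel)
        \<le> (\<integral>\<^sup>+ x. ennreal ((?f x + ?g x) powr q) \<partial>lborel)"
      using q by (intro nn_integral_mono ennreal_leI powr_mono2) (auto intro: norm_triangle_ineq)
    also have "\<dots> \<le> (\<integral>\<^sup>+ x. ennreal ((a+b) powr (q-1)) * (ennreal (1 / a powr (q-1)) * ennreal (?f x powr q)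
            + ennreal (1 / b powr (q-1)) * ennreal (?g x powr q)) \<partial>lborel)"
    proof (intro nn_integral_mono)
      fix x
      have "ennreal ((?f x + ?g x) powr q) \<le> ennreal ((a+b) powr (q-1) * (1 / a powr (q-1) * ?f x powr q
            + 1 / b powr (q-1) * ?g x powr q))"
        using powr_add_le_weighted[OF q a(1) b(1), of "?f x" "?g x"]
        by (intro ennreal_leI) (simp add: field_simps)
      then show "ennreal ((?f x + ?g x) powr q) \<le> ennreal ((a+b) powr (q-1)) * (ennreal (1 / a powr (q-1)) * ennreal (?f x powr q)
            + ennreal (1 / b powr (q-1)) * ennreal (?g x powr q))"
        by (simp flip: ennreal_mult'' ennreal_plus)
    qed
    also have "\<dots> = ennreal ((a+b) powr (q-1)) * (ennreal (1 / a powr (q-1)) * (\<integral>\<^sup>+ x. ennreal (?f x powr q) \<partial>lborel)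
          + ennreal (1 / b powr (q-1)) * (\<integral>\<^sup>+ x. ennreal (?g x powr q) \<partial>lborel))"
      by (simp add: nn_integral_cmult nn_integral_add)
    also have "\<dots> \<le> ennreal ((a+b) powr (q-1)) * (ennreal (1 / a powr (q-1)) * ennreal (a powr q)
          + ennreal (1 / b powr (q-1)) * ennreal (b powr q))"
      using Hp_norm_le_iff[OF p False, of a F] Hp_norm_le_iff[OF p False, of b G] a b y
      by (intro mult_left_mono add_mono) (auto simp: q_def)
    also have "\<dots> = ennreal ((a+b) powr (q-1) * (1 / a powr (q-1) * a powr q + 1 / b powr (q-1) * b powr q))"
      by (simp flip: ennreal_mult'' ennreal_plus)
    also have "\<dots> = ennreal ((a + b) powr q)"
      using a b by (simp add: powr_diff)
    finally show ?thesis .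
  qed
  then show ?thesis
    using Hp_norm_le_iff[OF p False, of "a + b" "\<lambda>z. F z + G z"] a b by (auto simp: q_def)
qed

lemma Hp_norm_triangle:
  assumes p: "1 \<le> p" and cont: "continuous_on uhp F" "continuous_on uhp G"
  shows "Hp_norm p (\<lambda>z. F z + G z) \<le> Hp_norm p F + Hp_norm p G"
proof (rule ennreal_le_epsilon)
  fix e :: real
  assume fin: "Hp_norm p F + Hp_norm p G < top" and e: "e > 0"
  then obtain a b where ab: "Hp_norm p F = ennreal a" "a \<ge> 0" "Hp_norm p G = ennreal b" "b \<ge> 0"
    by (cases "Hp_norm p F"; cases "Hp_norm p G") auto
  \<comment> \<open>The bounds are enlarged by \<open>e / 2\<close> because the weighted inequality divides by them.\<close>
  have "Hp_norm p (\<lambda>z. F z + G z) \<le> ennreal ((a + e/2) + (b + e/2))"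
    using ab e by (intro Hp_norm_add_le_real p cont) (auto intro!: ennreal_leI)
  also have "\<dots> = Hp_norm p F + Hp_norm p G + ennreal e"
    using ab e by (simp flip: ennreal_plus)
  finally show "Hp_norm p (\<lambda>z. F z + G z) \<le> Hp_norm p F + Hp_norm p G + ennreal e" .
qed

text \<open>
  Fatou's lemma on each line.  It is the source both of completeness and of lower semicontinuity.
\<close>
lemma Hp_norm_le_pointwise_limit:
  assumes p: "1 \<le> p" and cont: "\<And>j::nat. continuous_on uhp (G j)"
    and lim: "\<And>z. z \<in> uhp \<Longrightarrow> (\<lambda>j. G j z) \<longlonglongrightarrow> F z"
    and c: "c \<ge> 0" and bound: "\<And>j. Hp_norm p (G j) \<le> ennreal c"
  shows "Hp_norm p F \<le> ennreal c"
proof (cases "p = \<infinity>")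
  case True
  have "cmod (F z) \<le> c" if "z \<in> uhp" for z
    using Hp_norm_infinity_le_iff[OF c] bound that True
    by (intro LIMSEQ_le_const2[OF tendsto_norm[OF lim[OF that]]]) auto
  then show ?thesis using Hp_norm_infinity_le_iff[OF c] True by auto
next
  case False
  define q where "q = enn2real p"
  have q: "q \<ge> 1" using one_le_enn2real[OF p False] by (simp add: q_def)
  have "(\<integral>\<^sup>+ x. ennreal (cmod (F (Complex x y)) powr q) \<partial>lborel) \<le> ennreal (c powr q)"
    if y: "y > 0" for y
  proof -
    have "(\<lambda>j. ennreal (cmod (G j (Complex x y)) powr q)) \<longlonglongrightarrow> ennreal (cmod (F (Complex x y)) powr q)" for x
      using q y by (intro tendsto_ennrealI tendsto_powr' tendsto_norm lim) (auto simp: uhp_def)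
    then have "(\<integral>\<^sup>+ x. ennreal (cmod (F (Complex x y)) powr q) \<partial>lborel)
       = (\<integral>\<^sup>+ x. liminf (\<lambda>j. ennreal (cmod (G j (Complex x y)) powr q)) \<partial>lborel)"
      by (intro nn_integral_cong lim_imp_Liminf[symmetric] sequentially_bot)
    also have "\<dots> \<le> liminf (\<lambda>j. \<integral>\<^sup>+ x. ennreal (cmod (G j (Complex x y)) powr q) \<partial>lborel)"
    proof (intro nn_integral_liminf)
      fix j
      note [measurable] = slice_measurable[OF cont[of j] y]
      show "(\<lambda>x. ennreal (cmod (G j (Complex x y)) powr q)) \<in> borel_measurable lborel" by measurable
    qed
    also have "\<dots> \<le> liminf (\<lambda>j::nat. ennreal (c powr q))"
      using Hp_norm_le_iff[OF p False c] bound y by (intro Liminf_mono) (auto simp: q_def)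
    also have "\<dots> = ennreal (c powr q)" by (simp add: Liminf_const)
    finally show ?thesis .
  qed
  then show ?thesis
    using Hp_norm_le_iff[OF p False c] by (auto simp: q_def)
qed

section \<open>Point evaluations\<close>

text \<open>
  Cauchy's formula at a point that need not be the centre, but stays \<open>r / 2\<close> away from the circle; the
  kernel is then at most \<open>2 / r\<close>.  This leaves room for moving the circle while \<open>w\<close> is fixed.
\<close>
lemma cmod_le_circle_mean:
  assumes hol: "F holomorphic_on cball c r" and r: "r > 0" and w: "cmod (w - c) \<le> r / 2"
  shows "cmod (F w) \<le> 2 * integral {0..1} (\<lambda>t. cmod (F (circlepath c r t)))"
proof -
  have contF: "continuous_on (cball c r) F"
    using hol by (rule holomorphic_on_imp_continuous_on)
  have circ: "circlepath c r t \<in> cball c r" for t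
    using r by (simp add: circlepath dist_norm norm_mult norm_exp_eq_Re)
  have cont: "continuous_on {0..1} (\<lambda>t. F (circlepath c r t))"
    by (intro continuous_on_compose2[OF contF]) (auto simp: circlepath intro!: continuous_intros circ[unfolded circlepath])
  have "((\<lambda>u. F u / (u - w)) has_contour_integral (2 * of_real pi * \<i> * F w)) (circlepath c r)"
    using w r by (intro Cauchy_integral_circlepath_simple hol) auto
  then have int: "((\<lambda>t. F (circlepath c r t) / (circlepath c r t - w) * vector_derivative (circlepath c r) (at t))
      has_integral (2 * of_real pi * \<i> * F w)) {0..1}"
    by (simp add: has_contour_integral)
  have "norm (2 * of_real pi * \<i> * F w) \<le> integral {0..1} (\<lambda>t. 4 * pi * cmod (F (circlepath c r t)))"
    unfolding integral_unique[OF int, symmetric]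
  proof (intro integral_norm_bound_integral has_integral_integrable[OF int])
    show "(\<lambda>t. 4 * pi * cmod (F (circlepath c r t))) integrable_on {0..1}"
      using cont by (intro integrable_continuous_real continuous_intros)
    fix t :: real
    have "r = cmod ((circlepath c r t - w) + (w - c))"
      using r by (simp add: circlepath norm_mult norm_exp_eq_Re)
    also have "\<dots> \<le> cmod (circlepath c r t - w) + r / 2"
      using norm_triangle_ineq[of "circlepath c r t - w" "w - c"] w by linarith
    finally have far: "r / 2 \<le> cmod (circlepath c r t - w)" by simp
    have "norm (F (circlepath c r t) / (circlepath c r t - w) * vector_derivative (circlepath c r) (at t))
        = cmod (F (circlepath c r t)) / cmod (circlepath c r t - w) * (2 * pi * r)"
      using r by (simp add: vector_derivative_circlepath norm_mult norm_divide norm_exp_eq_Re)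
    also have "\<dots> \<le> cmod (F (circlepath c r t)) / (r / 2) * (2 * pi * r)"
      using far r less_le_trans[OF _ far, of 0] by (intro mult_right_mono divide_left_mono mult_pos_pos) auto
    also have "\<dots> = 4 * pi * cmod (F (circlepath c r t))"
      using r by simp
    finally show "norm (F (circlepath c r t) / (circlepath c r t - w) * vector_derivative (circlepath c r) (at t))
        \<le> 4 * pi * cmod (F (circlepath c r t))" .
  qed
  then show ?thesis
    by (simp add: norm_mult)
qed

text \<open>
  The crude bound \<open>x \<le> 1 + x\<^sup>q\<close> replaces Hoelder's inequality; the lost homogeneity is recovered by
  rescaling in \<open>cmod_le_Hp_norm\<close>.
\<close>
lemma slice_integral_le:
  assumes p: "1 \<le> p" "p \<noteq> \<infinity>" and cont: "continuous_on uhp F"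
    and norm: "Hp_norm p F \<le> 1" and z: "z \<in> uhp" and ab: "a \<le> b"
  shows "integral {a..b} (\<lambda>s. cmod (F (z + of_real s))) \<le> (b - a) + 1"
proof -
  let ?q = "enn2real p"
  have q: "?q \<ge> 1" using one_le_enn2real[OF p] .
  have y: "Im z > 0" using z by (simp add: uhp_def)
  have line: "z + of_real s = Complex (Re z + s) (Im z)" for s
    by (simp add: complex_eq_iff)
  have cont_slice: "continuous_on S (\<lambda>s. F (z + of_real s))" for S
    using y by (intro continuous_on_compose2[OF cont] continuous_intros) (auto simp: uhp_def)
  have cont_powr: "continuous_on S (\<lambda>s. cmod (F (z + of_real s)) powr ?q)" for S
    using q by (intro continuous_on_powr' continuous_intros cont_slice) auto
  have "ennreal (integral {a..b} (\<lambda>s. cmod (F (z + of_real s)) powr ?q))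
      = (\<integral>\<^sup>+ s. ennreal (cmod (F (z + of_real s)) powr ?q) * indicator {a..b} s \<partial>lborel)"
    by (intro nn_integral_has_integral_lebesgue'[symmetric] integrable_integral
        integrable_continuous_real cont_powr) auto
  also have "\<dots> \<le> (\<integral>\<^sup>+ s. ennreal (cmod (F (z + of_real s)) powr ?q) \<partial>lborel)"
    by (intro nn_integral_mono) (auto simp: indicator_def)
  also have "\<dots> = (\<integral>\<^sup>+ x. ennreal (cmod (F (Complex x (Im z))) powr ?q) \<partial>lborel)"
  proof -
    note [measurable] = slice_measurable[OF cont y]
    have "(\<integral>\<^sup>+ x. ennreal (cmod (F (Complex x (Im z))) powr ?q) \<partial>lborel)
       = ennreal \<bar>1\<bar> * (\<integral>\<^sup>+ x. ennreal (cmod (F (Complex (Re z + 1 * x) (Im z))) powr ?q) \<partial>lborel)"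
      by (intro nn_integral_real_affine) measurable
    then show ?thesis by (simp add: line)
  qed
  also have "\<dots> \<le> ennreal 1"
    using Hp_norm_le_iff[OF p, of 1 F] norm y by simp
  finally have powr_le: "integral {a..b} (\<lambda>s. cmod (F (z + of_real s)) powr ?q) \<le> 1"
    by simp
  have "integral {a..b} (\<lambda>s. cmod (F (z + of_real s)))
      \<le> integral {a..b} (\<lambda>s. 1 + cmod (F (z + of_real s)) powr ?q)"
  proof (rule integral_le)
    show "(\<lambda>s. cmod (F (z + of_real s))) integrable_on {a..b}"
      by (intro integrable_continuous_real continuous_on_norm cont_slice)
    show "(\<lambda>s. 1 + cmod (F (z + of_real s)) powr ?q) integrable_on {a..b}"
      by (intro integrable_continuous_real continuous_on_add continuous_on_const cont_powr)
    fix s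
    let ?x = "cmod (F (z + of_real s))"
    show "?x \<le> 1 + ?x powr ?q"
    proof (cases "?x \<le> 1")
      case False
      then show ?thesis using powr_mono[of 1 ?q ?x] q by simp
    next
      case True
      then show ?thesis using powr_ge_zero[of ?x ?q] by linarith
    qed
  qed
  also have "\<dots> = (b - a) + integral {a..b} (\<lambda>s. cmod (F (z + of_real s)) powr ?q)"
    using ab by (subst integral_add) (auto intro!: integrable_continuous_real cont_powr)
  finally show ?thesis using powr_le by simp
qed

text \<open>
  The circles around \<open>w + s\<close>, \<open>\<bar>s\<bar> \<le> r / 2\<close>, are horizontal translates of each other.  Averaging Cauchy's
  formula over \<open>s\<close> and exchanging the integrals leaves, for each angle, an integral of \<open>\<bar>F\<bar>\<close> over a
  horizontal segment, which is what the Hardy norm controls; the length of the segment is \<open>r\<close>.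
\<close>
lemma cmod_le_if_Hp_norm_le_1:
  assumes p: "1 \<le> p" and hol: "F holomorphic_on uhp" and norm: "Hp_norm p F \<le> 1"
    and r: "r > 0" and w: "r < Im w"
  shows "cmod (F w) \<le> 2 + 2 / r"
proof (cases "p = \<infinity>")
  case True
  have "w \<in> uhp" using r w by (simp add: uhp_def)
  then have "cmod (F w) \<le> 1"
    using Hp_norm_infinity_le_iff[of 1 F] norm True by auto
  moreover have "0 \<le> 2 / r" using r by simp
  ultimately show ?thesis by linarith
next
  case False
  have contF: "continuous_on uhp F"
    using hol by (rule holomorphic_on_imp_continuous_on)
  let ?\<gamma> = "circlepath w r"
  have shift: "circlepath (w + of_real s) r t = ?\<gamma> t + of_real s" for s t
    by (simp add: circlepath)
  have Im_ge: "Im w - r \<le> Im (?\<gamma> t)" for t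
  proof -
    have "\<bar>Im (?\<gamma> t - w)\<bar> \<le> cmod (?\<gamma> t - w)" by (rule abs_Im_le_cmod)
    also have "\<dots> = r" using r by (simp add: circlepath norm_mult norm_exp_eq_Re)
    finally show ?thesis by simp
  qed
  have pos: "0 < Im (?\<gamma> t)" for t
    using Im_ge[of t] w by linarith
  have cball_sub: "cball (w + of_real s) r \<subseteq> uhp" for s
  proof
    fix z assume "z \<in> cball (w + of_real s) r"
    then have "\<bar>Im (z - (w + of_real s))\<bar> \<le> r"
      using abs_Im_le_cmod[of "z - (w + of_real s)"] by (auto simp: dist_norm norm_minus_commute)
    then show "z \<in> uhp" using w by (simp add: uhp_def)
  qed
  have cont2: "continuous_on S (\<lambda>(s, t). cmod (F (?\<gamma> t + of_real s)))" for S
    unfolding case_prod_unfold circlepath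
    using pos by (intro continuous_on_compose2[OF contF] continuous_intros)
      (auto simp: uhp_def circlepath)
  let ?I = "\<lambda>s. integral {0..1} (\<lambda>t. cmod (F (?\<gamma> t + of_real s)))"
  have "r * cmod (F w) = integral {-r/2..r/2} (\<lambda>s. cmod (F w))"
    using r by simp
  also have "\<dots> \<le> integral {-r/2..r/2} (\<lambda>s. 2 * ?I s)"
  proof (intro integral_le)
    show "(\<lambda>s. 2 * ?I s) integrable_on {-r/2..r/2}"
      using integral_continuous_on_param[of "{-r/2..r/2}" 0 1 "\<lambda>s t. cmod (F (?\<gamma> t + of_real s))"] cont2
      by (intro integrable_continuous_real continuous_intros) simp
    fix s assume "s \<in> {-r/2..r/2}"
    then have "cmod (w - (w + of_real s)) \<le> r / 2" by auto
    then show "cmod (F w) \<le> 2 * ?I s"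
      using cmod_le_circle_mean[OF holomorphic_on_subset[OF hol cball_sub] r, of w s]
      by (simp add: shift)
  qed auto
  also have "\<dots> = 2 * integral {-r/2..r/2} ?I"
    by simp
  also have "integral {-r/2..r/2} ?I
      = integral {0..1} (\<lambda>t. integral {-r/2..r/2} (\<lambda>s. cmod (F (?\<gamma> t + of_real s))))"
    using integral_swap_continuous[of "-r/2" 0 "r/2" 1 "\<lambda>s t. cmod (F (?\<gamma> t + of_real s))", OF cont2]
    by simp
  also have "\<dots> \<le> integral {0..1} (\<lambda>t::real. r + 1)"
  proof (intro integral_le)
    have "continuous_on UNIV (\<lambda>(t, s). cmod (F (?\<gamma> t + of_real s)))"
      using continuous_on_swap_args[OF cont2[of "UNIV \<times> UNIV"]] by simp
    then show "(\<lambda>t. integral {-r/2..r/2} (\<lambda>s. cmod (F (?\<gamma> t + of_real s)))) integrable_on {0..1}"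
      using integral_continuous_on_param[of "{0..1}" "-r/2" "r/2" "\<lambda>t s. cmod (F (?\<gamma> t + of_real s))"]
      by (intro integrable_continuous_real) (auto intro: continuous_on_subset)
    fix t
    have "?\<gamma> t \<in> uhp" using pos by (simp add: uhp_def)
    then show "integral {-r/2..r/2} (\<lambda>s. cmod (F (?\<gamma> t + of_real s))) \<le> r + 1"
      using slice_integral_le[OF p False contF norm, of "?\<gamma> t" "-r/2" "r/2"] r by simp
  qed auto
  also have "\<dots> = r + 1" by simp
  finally show ?thesis using r by (simp add: field_simps)
qed

text \<open>
  The constant is uniform on each half-plane \<open>Im w > r\<close>, so that norm convergence implies locally uniform
  convergence.
\<close>
lemma cmod_le_Hp_norm:
  assumes p: "1 \<le> p" and hol: "F holomorphic_on uhp" and norm: "Hp_norm p F \<le> ennreal c"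
    and c: "c \<ge> 0" and r: "r > 0" and w: "r < Im w"
  shows "cmod (F w) \<le> (2 + 2 / r) * c"
proof (rule field_le_epsilon)
  fix e :: real assume e: "e > 0"
  let ?K = "2 + 2 / r"
  have K: "?K > 0" using r by (simp add: add_pos_pos)
  define d where "d = c + e / ?K"
  have d: "d > 0" using c e K by (simp add: d_def add_nonneg_pos)
  have cd: "c \<le> d" using e K by (simp add: d_def)
  have "Hp_norm p (\<lambda>z. of_real (1 / d) * F z) \<le> ennreal (cmod (of_real (1 / d))) * Hp_norm p F"
    by (intro Hp_norm_cmult_le p holomorphic_on_imp_continuous_on hol)
  also have "\<dots> \<le> ennreal (1 / d) * ennreal d"
    using d order.trans[OF norm ennreal_leI[OF cd]] by (intro mult_mono) (auto simp: norm_divide)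
  also have "\<dots> = 1"
    using d by (simp flip: ennreal_mult'')
  finally have "cmod (of_real (1 / d) * F w) \<le> ?K"
    by (intro cmod_le_if_Hp_norm_le_1[OF p _ _ r w] holomorphic_intros hol) auto
  then have "cmod (F w) \<le> ?K * d"
    using d by (simp add: norm_mult norm_divide field_simps)
  also have "\<dots> = ?K * c + e" using K by (simp add: d_def distrib_left)
  finally show "cmod (F w) \<le> ?K * c + e" .
qed

section \<open>Lower semicontinuous seminorms on Banach spaces\<close>

text \<open>
  The sublevel sets \<open>{F. s F \<le> m}\<close> are closed and cover the space, so by Baire's theorem one of them
  contains a ball around some \<open>F\<^sub>0\<close>.  Translating the ball to the origin bounds \<open>s\<close> on a neighbourhood of
  zero, hence everywhere by homogeneity.
\<close>
lemma lower_semicontinuous_seminorm_bounded: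
  fixes X :: "('a \<Rightarrow> complex) set" and N s :: "('a \<Rightarrow> complex) \<Rightarrow> real"
  assumes add: "\<And>F G. F \<in> X \<Longrightarrow> G \<in> X \<Longrightarrow> (\<lambda>z. F z + G z) \<in> X"
    and scale: "\<And>F c. F \<in> X \<Longrightarrow> (\<lambda>z. c * F z) \<in> X"
    and ne: "X \<noteq> {}"
    and N_nonneg: "\<And>F. 0 \<le> N F"
    and N_zero: "\<And>F. F \<in> X \<Longrightarrow> N F = 0 \<longleftrightarrow> F = (\<lambda>z. 0)"
    and N_add: "\<And>F G. F \<in> X \<Longrightarrow> G \<in> X \<Longrightarrow> N (\<lambda>z. F z + G z) \<le> N F + N G"
    and N_scale: "\<And>F c. F \<in> X \<Longrightarrow> N (\<lambda>z. c * F z) \<le> cmod c * N F"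
    and N_complete: "\<And>\<sigma>::nat \<Rightarrow> 'a \<Rightarrow> complex. range \<sigma> \<subseteq> X \<Longrightarrow>
        (\<And>e. e > 0 \<Longrightarrow> \<exists>J. \<forall>i\<ge>J. \<forall>j\<ge>J. N (\<lambda>z. \<sigma> i z - \<sigma> j z) < e) \<Longrightarrow>
        \<exists>F\<in>X. (\<lambda>j. N (\<lambda>z. \<sigma> j z - F z)) \<longlonglongrightarrow> 0"
    and s_add: "\<And>F G. F \<in> X \<Longrightarrow> G \<in> X \<Longrightarrow> s (\<lambda>z. F z + G z) \<le> s F + s G"
    and s_scale: "\<And>F c. F \<in> X \<Longrightarrow> s (\<lambda>z. c * F z) \<le> cmod c * s F"
    and s_lsc: "\<And>(\<sigma>::nat \<Rightarrow> 'a \<Rightarrow> complex) F m. range \<sigma> \<subseteq> X \<Longrightarrow> F \<in> X \<Longrightarrow>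
        (\<lambda>j. N (\<lambda>z. \<sigma> j z - F z)) \<longlonglongrightarrow> 0 \<Longrightarrow> (\<And>j. s (\<sigma> j) \<le> real m) \<Longrightarrow> s F \<le> real m"
  shows "\<exists>C\<ge>0. \<forall>F\<in>X. s F \<le> C * N F"
proof -
  have zero_mem: "(\<lambda>z. 0) \<in> X"
    using ne scale[of _ 0] by auto
  have diff: "(\<lambda>z. F z - G z) \<in> X" if "F \<in> X" "G \<in> X" for F G
    using add[OF that(1) scale[OF that(2), of "-1"]] by simp
  have N_swap: "N (\<lambda>z. F z - G z) = N (\<lambda>z. G z - F z)" if "F \<in> X" "G \<in> X" for F G
    using N_scale[OF diff[OF that], of "-1"] N_scale[OF diff[OF that(2,1)], of "-1"] by simp
  \<comment> \<open>Symmetry of a metric is required on the whole type, but is known for \<open>N\<close> on \<open>X\<close> only.\<close>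
  define d where "d F G = (if F \<in> X \<and> G \<in> X then N (\<lambda>z. F z - G z) else 0)" for F G
  interpret Metric_space X d
  proof
    show "0 \<le> d F G" for F G by (simp add: d_def N_nonneg)
    show "d F G = d G F" for F G
      using N_swap[of F G] by (auto simp: d_def)
    fix F G assume FG: "F \<in> X" "G \<in> X"
    show "d F G = 0 \<longleftrightarrow> F = G"
      using N_zero[OF diff[OF FG]] FG by (auto simp: fun_eq_iff d_def)
    fix H assume H: "H \<in> X"
    show "d F H \<le> d F G + d G H"
      using N_add[OF diff[OF FG] diff[OF FG(2) H]] FG H by (simp add: d_def)
  qed
  have complete: "mcomplete"
    unfolding mcomplete_def
  proof (intro allI impI)
    fix \<sigma> assume Cauchy: "MCauchy \<sigma>"
    then have sub: "range \<sigma> \<subseteq> X" by (simp add: MCauchy_def)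
    then have mem: "\<sigma> i \<in> X" for i by (simp add: image_subset_iff)
    have cauchy: "\<exists>J. \<forall>i\<ge>J. \<forall>j\<ge>J. N (\<lambda>z. \<sigma> i z - \<sigma> j z) < e" if "e > 0" for e
    proof -
      obtain J where "\<forall>i j. J \<le> i \<longrightarrow> J \<le> j \<longrightarrow> d (\<sigma> i) (\<sigma> j) < e"
        using conjunct2[OF Cauchy[unfolded MCauchy_def]] \<open>e > 0\<close> by meson
      then have "\<forall>i\<ge>J. \<forall>j\<ge>J. d (\<sigma> i) (\<sigma> j) < e" by blast
      then show ?thesis using mem unfolding d_def by auto
    qed
    obtain F where F: "F \<in> X" "(\<lambda>j. N (\<lambda>z. \<sigma> j z - F z)) \<longlonglongrightarrow> 0"
      using N_complete[OF sub cauchy] by blast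
    then show "\<exists>F. limitin mtopology \<sigma> F sequentially"
      by (auto simp: limitin_metric_dist_null d_def mem)
  qed
  define A where "A m = {F \<in> X. s F \<le> real m}" for m
  have A_closed: "closedin mtopology (A m)" for m
    unfolding metric_closedin_iff_sequentially_closed
  proof (intro conjI allI impI)
    show "A m \<subseteq> X" by (auto simp: A_def)
    fix \<sigma> F assume "range \<sigma> \<subseteq> A m \<and> limitin mtopology \<sigma> F sequentially"
    then have mem: "\<And>j. \<sigma> j \<in> X" "\<And>j. s (\<sigma> j) \<le> real m" and F: "F \<in> X"
      and lim: "(\<lambda>j. d (\<sigma> j) F) \<longlonglongrightarrow> 0"
      by (auto simp: A_def limitin_metric_dist_null)
    show "F \<in> A m"
      using s_lsc[of \<sigma> F m] mem F lim by (auto simp: A_def d_def)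
  qed
  have "\<exists>m. mtopology interior_of A m \<noteq> {}"
  proof (rule ccontr)
    assume "\<not> (\<exists>m. mtopology interior_of A m \<noteq> {})"
    then have "mtopology interior_of (\<Union>(range A)) = {}"
      using A_closed by (intro metric_Baire_category_alt complete) auto
    moreover have "\<Union>(range A) = X"
      by (auto simp: A_def real_arch_simple)
    ultimately show False
      using ne by (simp add: interior_of_topspace[of mtopology, simplified])
  qed
  then obtain m F0 where F0: "F0 \<in> mtopology interior_of A m" by blast
  then obtain r where r: "r > 0" "mball F0 r \<subseteq> A m"
    by (auto simp: metric_interior_of)
  have F0X: "F0 \<in> X"
    using F0 interior_of_subset[of mtopology "A m"] by (auto simp: A_def)
  define c where "c = real m + s (\<lambda>z. -1 * F0 z)"
  have small: "s F \<le> c" if F: "F \<in> X" "N F < r" for F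
  proof -
    have in_ball: "(\<lambda>z. F0 z + F z) \<in> mball F0 r"
      using F F0X N_swap[OF add[OF F0X F(1)] F0X] by (simp add: d_def add)
    have "s F \<le> s (\<lambda>z. F0 z + F z) + s (\<lambda>z. -1 * F0 z)"
      using s_add[OF add[OF F0X F(1)] scale[OF F0X, of "-1"]] by simp
    then show ?thesis
      using in_ball r(2) by (auto simp: A_def c_def)
  qed
  have c0: "0 \<le> c"
    using small[OF zero_mem] s_scale[OF zero_mem, of 2] N_zero[OF zero_mem] r by simp
  have "s F \<le> 2 * c / r * N F" if F: "F \<in> X" for F
  proof (cases "N F = 0")
    case True
    then show ?thesis
      using N_zero[OF F] s_scale[OF F, of 0] by simp
  next
    case False
    then have pos: "N F > 0" using N_nonneg[of F] by linarith
    define l where "l = r / (2 * N F)"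
    have l: "l > 0" using pos r by (simp add: l_def)
    have "N (\<lambda>z. of_real l * F z) \<le> l * N F"
      using N_scale[OF F, of "of_real l"] l by simp
    also have "l * N F < r" using pos r by (simp add: l_def)
    finally have le_c: "s (\<lambda>z. of_real l * F z) \<le> c"
      by (intro small scale F)
    have "s F = s (\<lambda>z. of_real (1 / l) * (of_real l * F z))"
      using l by simp
    also have "\<dots> \<le> 1 / l * s (\<lambda>z. of_real l * F z)"
      using s_scale[OF scale[OF F, of "of_real l"], of "of_real (1 / l)"] l by (simp add: norm_divide)
    also have "\<dots> \<le> 1 / l * c"
      using le_c l by (intro mult_left_mono) auto
    also have "\<dots> = 2 * c / r * N F"
      by (simp add: l_def)
    finally show ?thesis .
  qed
  then show ?thesis
    using c0 r by (intro exI[of _ "2 * c / r"]) auto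
qed

section \<open>The Banach space structure of the Sobolev-Hardy spaces\<close>

lemma uhp_deriv_holomorphic:
  assumes "F holomorphic_on uhp"
  shows "uhp_deriv k F holomorphic_on uhp"
proof -
  have "(deriv ^^ k) F holomorphic_on uhp"
    using assms open_uhp by (rule holomorphic_higher_deriv)
  then show ?thesis
    by (rule holomorphic_transform) (simp add: uhp_deriv_def)
qed

lemma uhp_deriv_continuous:
  "F holomorphic_on uhp \<Longrightarrow> continuous_on uhp (uhp_deriv k F)"
  by (intro holomorphic_on_imp_continuous_on uhp_deriv_holomorphic)

lemma uhp_deriv_add:
  assumes "F holomorphic_on uhp" "G holomorphic_on uhp"
  shows "uhp_deriv k (\<lambda>z. F z + G z) = (\<lambda>z. uhp_deriv k F z + uhp_deriv k G z)"
  using higher_deriv_add[OF assms open_uhp] by (auto simp: uhp_deriv_def fun_eq_iff)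

lemma uhp_deriv_cmult:
  assumes "F holomorphic_on uhp"
  shows "uhp_deriv k (\<lambda>z. c * F z) = (\<lambda>z. c * uhp_deriv k F z)"
  using higher_deriv_cmult[OF assms _ open_uhp] by (auto simp: uhp_deriv_def fun_eq_iff)

lemma uhp_deriv_diff:
  assumes "F holomorphic_on uhp" "G holomorphic_on uhp"
  shows "uhp_deriv k (\<lambda>z. F z - G z) = (\<lambda>z. uhp_deriv k F z - uhp_deriv k G z)"
  using higher_deriv_diff[OF assms open_uhp] by (auto simp: uhp_deriv_def fun_eq_iff)

text \<open>
  A norm equivalent to \<^const>\<open>Hnp_norm\<close>.  Its upper bounds are conjunctions of upper bounds for the
  Hardy norms of the derivatives, so that Minkowski's inequality and Fatou's lemma carry over
  at once, and all exponents are treated alike.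
\<close>
definition Hnp_max_norm :: "nat \<Rightarrow> ennreal \<Rightarrow> (complex \<Rightarrow> complex) \<Rightarrow> ennreal" where
  "Hnp_max_norm n p F = (SUP k\<in>{..n}. Hp_norm p (uhp_deriv k F))"

lemma Hnp_max_norm_le_iff:
  "Hnp_max_norm n p F \<le> c \<longleftrightarrow> (\<forall>k\<le>n. Hp_norm p (uhp_deriv k F) \<le> c)"
  by (auto simp: Hnp_max_norm_def SUP_le_iff)

lemma Hp_norm_uhp_deriv_le:
  "k \<le> n \<Longrightarrow> Hp_norm p (uhp_deriv k F) \<le> Hnp_max_norm n p F"
  using Hnp_max_norm_le_iff[of n p F "Hnp_max_norm n p F"] by simp

lemma Hnp_iff:
  "F \<in> Hnp n p \<longleftrightarrow> F holomorphic_on uhp \<and> (\<forall>z. z \<notin> uhp \<longrightarrow> F z = 0) \<and> Hnp_max_norm n p F < \<infinity>"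
proof -
  have "Hnp_max_norm n p F < \<infinity> \<longleftrightarrow> (\<forall>k\<le>n. Hp_norm p (uhp_deriv k F) < \<infinity>)"
    unfolding Hnp_max_norm_def by (subst finite_Sup_less_iff) auto
  then show ?thesis
    unfolding Hnp_def Hp_def by (auto simp: uhp_deriv_holomorphic) (auto simp: uhp_deriv_def)
qed

lemma Hnp_max_norm_add:
  assumes "1 \<le> p" "F holomorphic_on uhp" "G holomorphic_on uhp"
  shows "Hnp_max_norm n p (\<lambda>z. F z + G z) \<le> Hnp_max_norm n p F + Hnp_max_norm n p G"
  unfolding Hnp_max_norm_le_iff uhp_deriv_add[OF assms(2,3)]
proof (intro allI impI)
  fix k assume "k \<le> n"
  then show "Hp_norm p (\<lambda>z. uhp_deriv k F z + uhp_deriv k G z) \<le> Hnp_max_norm n p F + Hnp_max_norm n p G"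
    by (intro order.trans[OF Hp_norm_triangle add_mono] assms uhp_deriv_continuous Hp_norm_uhp_deriv_le)
qed

lemma Hnp_max_norm_cmult:
  assumes "1 \<le> p" "F holomorphic_on uhp"
  shows "Hnp_max_norm n p (\<lambda>z. c * F z) \<le> ennreal (cmod c) * Hnp_max_norm n p F"
  unfolding Hnp_max_norm_le_iff uhp_deriv_cmult[OF assms(2)]
proof (intro allI impI)
  fix k assume "k \<le> n"
  then show "Hp_norm p (\<lambda>z. c * uhp_deriv k F z) \<le> ennreal (cmod c) * Hnp_max_norm n p F"
    by (intro order.trans[OF Hp_norm_cmult_le mult_left_mono] assms uhp_deriv_continuous Hp_norm_uhp_deriv_le) auto
qed

lemma Hnp_add:
  assumes "1 \<le> p" "F \<in> Hnp n p" "G \<in> Hnp n p"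
  shows "(\<lambda>z. F z + G z) \<in> Hnp n p"
  unfolding Hnp_iff
proof (intro conjI)
  show "(\<lambda>z. F z + G z) holomorphic_on uhp" "\<forall>z. z \<notin> uhp \<longrightarrow> F z + G z = 0"
    using assms by (auto simp: Hnp_iff intro: holomorphic_on_add)
  have "Hnp_max_norm n p F + Hnp_max_norm n p G < \<infinity>"
    using assms by (simp add: Hnp_iff)
  then show "Hnp_max_norm n p (\<lambda>z. F z + G z) < \<infinity>"
    using assms by (intro le_less_trans[OF Hnp_max_norm_add]) (auto simp: Hnp_iff)
qed

lemma Hnp_cmult:
  assumes "1 \<le> p" "F \<in> Hnp n p"
  shows "(\<lambda>z. c * F z) \<in> Hnp n p"
  unfolding Hnp_iff
proof (intro conjI)
  show "(\<lambda>z. c * F z) holomorphic_on uhp" "\<forall>z. z \<notin> uhp \<longrightarrow> c * F z = 0"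
    using assms by (auto simp: Hnp_iff intro: holomorphic_on_mult)
  have "ennreal (cmod c) * Hnp_max_norm n p F < \<infinity>"
    using assms by (simp add: Hnp_iff ennreal_mult_less_top)
  then show "Hnp_max_norm n p (\<lambda>z. c * F z) < \<infinity>"
    using assms by (intro le_less_trans[OF Hnp_max_norm_cmult]) (auto simp: Hnp_iff)
qed

lemma Hnp_diff:
  assumes "1 \<le> p" "F \<in> Hnp n p" "G \<in> Hnp n p"
  shows "(\<lambda>z. F z - G z) \<in> Hnp n p"
  using Hnp_add[OF assms(1,2) Hnp_cmult[OF assms(1,3), of "-1"]] by simp

lemma ennreal_powr_le_iff:
  assumes "q \<ge> 1" "c \<ge> 0"
  shows "ennreal_powr x q \<le> ennreal (c powr q) \<longleftrightarrow> x \<le> ennreal c"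
proof (cases x)
  case (real r)
  have "r powr q \<le> c powr q \<longleftrightarrow> r \<le> c"
    using assms real powr_less_mono2[of q c r] by (auto simp: powr_mono2 not_le[symmetric])
  then show ?thesis
    using real assms by (simp add: ennreal_powr_def)
qed (simp add: ennreal_powr_def top_unique)

lemma Hnp_max_norm_le_Hnp_norm:
  assumes p: "1 \<le> p"
  shows "Hnp_max_norm n p F \<le> Hnp_norm n p F"
proof (cases "p = \<infinity>")
  case True
  then show ?thesis
    unfolding Hnp_max_norm_le_iff Hnp_norm_def by (auto intro!: member_le_sum)
next
  case False
  have q: "enn2real p \<ge> 1" using one_le_enn2real[OF p False] .
  show ?thesis
  proof (cases "Hnp_norm n p F")
    case (real c)
    have "(\<Sum>k\<le>n. ennreal_powr (Hp_norm p (uhp_deriv k F)) (enn2real p)) \<le> ennreal (c powr enn2real p)"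
    proof (rule ennreal_powr_inverse_le_iff[OF q, THEN iffD1])
      show "ennreal_powr (\<Sum>k\<le>n. ennreal_powr (Hp_norm p (uhp_deriv k F)) (enn2real p)) (1 / enn2real p) \<le> ennreal c"
        using real(2) False by (simp add: Hnp_norm_def)
    qed (fact real(1))
    moreover have "ennreal_powr (Hp_norm p (uhp_deriv k F)) (enn2real p)
        \<le> (\<Sum>k\<le>n. ennreal_powr (Hp_norm p (uhp_deriv k F)) (enn2real p))" if "k \<le> n" for k
      using that by (intro member_le_sum) auto
    ultimately have "ennreal_powr (Hp_norm p (uhp_deriv k F)) (enn2real p) \<le> ennreal (c powr enn2real p)" if "k \<le> n" for k
      using that by (meson order.trans)
    then show ?thesis
      using real q by (simp add: Hnp_max_norm_le_iff ennreal_powr_le_iff)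
  qed simp
qed

lemma Hnp_norm_le_Hnp_max_norm:
  assumes p: "1 \<le> p"
  shows "Hnp_norm n p F \<le> ennreal (real (Suc n)) * Hnp_max_norm n p F"
proof (cases "p = \<infinity>")
  case True
  have "(\<Sum>k\<le>n. Hp_norm p (uhp_deriv k F)) \<le> (\<Sum>k\<le>n. Hnp_max_norm n p F)"
    by (intro sum_mono Hp_norm_uhp_deriv_le) auto
  then show ?thesis
    using True by (simp add: Hnp_norm_def ennreal_of_nat_eq_real_of_nat[symmetric] del: of_nat_Suc)
next
  case False
  have q: "enn2real p \<ge> 1" using one_le_enn2real[OF p False] .
  show ?thesis
  proof (cases "Hnp_max_norm n p F")
    case (real c)
    have "(\<Sum>k\<le>n. ennreal_powr (Hp_norm p (uhp_deriv k F)) (enn2real p))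
        \<le> (\<Sum>k\<le>n. ennreal (c powr enn2real p))"
      using real q Hp_norm_uhp_deriv_le[of _ n p F]
      by (intro sum_mono) (simp add: ennreal_powr_le_iff)
    also have "\<dots> = ennreal (real (Suc n) * c powr enn2real p)"
      by (simp add: ennreal_mult ennreal_of_nat_eq_real_of_nat del: of_nat_Suc)
    also have "\<dots> \<le> ennreal ((real (Suc n) * c) powr enn2real p)"
      using powr_mono[of 1 "enn2real p" "real (Suc n)"] q
      by (intro ennreal_leI) (simp add: powr_mult mult_right_mono del: of_nat_Suc)
    finally have "Hnp_norm n p F \<le> ennreal (real (Suc n) * c)"
      using False real ennreal_powr_inverse_le_iff[OF q, of "real (Suc n) * c"]
      by (simp add: Hnp_norm_def del: of_nat_Suc)
    then show ?thesis
      using real by (simp add: ennreal_mult del: of_nat_Suc)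
  qed (simp add: ennreal_mult_top)
qed

text \<open>
  The real version serves as a norm in the sense of metric spaces; it is meaningful on \<^const>\<open>Hnp\<close>
  only, since \<^const>\<open>enn2real\<close> sends infinity to zero.
\<close>
definition Hnp_max_real_norm :: "nat \<Rightarrow> ennreal \<Rightarrow> (complex \<Rightarrow> complex) \<Rightarrow> real" where
  "Hnp_max_real_norm n p F = enn2real (Hnp_max_norm n p F)"

lemma Hnp_max_norm_eq:
  "F \<in> Hnp n p \<Longrightarrow> Hnp_max_norm n p F = ennreal (Hnp_max_real_norm n p F)"
  by (simp add: Hnp_iff Hnp_max_real_norm_def)

lemma Hnp_max_real_norm_nonneg: "0 \<le> Hnp_max_real_norm n p F"
  by (simp add: Hnp_max_real_norm_def)

lemma Hnp_max_real_norm_le: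
  "Hnp_max_norm n p F \<le> ennreal c \<Longrightarrow> 0 \<le> c \<Longrightarrow> Hnp_max_real_norm n p F \<le> c"
  unfolding Hnp_max_real_norm_def by (rule enn2real_leI)

lemma Hnp_max_real_norm_add:
  assumes "1 \<le> p" "F \<in> Hnp n p" "G \<in> Hnp n p"
  shows "Hnp_max_real_norm n p (\<lambda>z. F z + G z) \<le> Hnp_max_real_norm n p F + Hnp_max_real_norm n p G"
  using Hnp_max_norm_add[of p F G n] assms
  by (intro Hnp_max_real_norm_le) (auto simp: Hnp_max_norm_eq Hnp_max_real_norm_nonneg Hnp_iff)

lemma Hnp_max_real_norm_cmult:
  assumes "1 \<le> p" "F \<in> Hnp n p"
  shows "Hnp_max_real_norm n p (\<lambda>z. c * F z) \<le> cmod c * Hnp_max_real_norm n p F"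
proof (rule Hnp_max_real_norm_le)
  show "Hnp_max_norm n p (\<lambda>z. c * F z) \<le> ennreal (cmod c * Hnp_max_real_norm n p F)"
    using Hnp_max_norm_cmult[of p F n c] assms Hnp_max_norm_eq[OF assms(2)]
    by (simp add: ennreal_mult Hnp_max_real_norm_nonneg Hnp_iff)
qed (simp add: Hnp_max_real_norm_nonneg)

lemma cmod_uhp_deriv_le:
  assumes p: "1 \<le> p" and F: "F \<in> Hnp n p" and k: "k \<le> n" and r: "r > 0" and w: "r < Im w"
  shows "cmod (uhp_deriv k F w) \<le> (2 + 2 / r) * Hnp_max_real_norm n p F"
proof (rule cmod_le_Hp_norm[OF p _ _ _ r w])
  show "uhp_deriv k F holomorphic_on uhp"
    using F by (simp add: Hnp_iff uhp_deriv_holomorphic)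
  show "Hp_norm p (uhp_deriv k F) \<le> ennreal (Hnp_max_real_norm n p F)"
    using Hp_norm_uhp_deriv_le[OF k, of p F] Hnp_max_norm_eq[OF F] by simp
qed (rule Hnp_max_real_norm_nonneg)

lemma cmod_le_Hnp_norm:
  assumes "1 \<le> p" "F \<in> Hnp n p" "r > 0" "r < Im w"
  shows "cmod (F w) \<le> (2 + 2 / r) * Hnp_max_real_norm n p F"
  using cmod_uhp_deriv_le[of p F n 0 r w] assms by (simp add: uhp_deriv_def uhp_def)

lemma Hnp_max_norm_le_pointwise_limit:
  assumes p: "1 \<le> p" and hol: "\<And>j::nat. G j holomorphic_on uhp"
    and lim: "\<And>k z. k \<le> n \<Longrightarrow> z \<in> uhp \<Longrightarrow> (\<lambda>j. uhp_deriv k (G j) z) \<longlonglongrightarrow> uhp_deriv k F z"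
    and c: "c \<ge> 0" and bound: "\<And>j. Hnp_max_norm n p (G j) \<le> ennreal c"
  shows "Hnp_max_norm n p F \<le> ennreal c"
  unfolding Hnp_max_norm_le_iff
proof (intro allI impI)
  fix k assume k: "k \<le> n"
  show "Hp_norm p (uhp_deriv k F) \<le> ennreal c"
  proof (rule Hp_norm_le_pointwise_limit[OF p])
    show "continuous_on uhp (uhp_deriv k (G j))" for j
      by (rule uhp_deriv_continuous[OF hol])
    show "(\<lambda>j. uhp_deriv k (G j) z) \<longlonglongrightarrow> uhp_deriv k F z" if "z \<in> uhp" for z
      using k that by (rule lim)
    show "Hp_norm p (uhp_deriv k (G j)) \<le> ennreal c" for j
      using Hp_norm_uhp_deriv_le[OF k] bound by (rule order.trans)
  qed (fact c)
qed

text \<open>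
  A Cauchy sequence converges uniformly on every half-plane \<open>Im z > r\<close> because point evaluations are
  bounded there, so its limit is holomorphic and all derivatives converge pointwise.  Fatou's lemma, applied
  to the differences with a fixed member, then gives convergence in norm.
\<close>
lemma Hnp_complete:
  fixes \<sigma> :: "nat \<Rightarrow> complex \<Rightarrow> complex"
  assumes p: "1 \<le> p" and mem: "\<And>j. \<sigma> j \<in> Hnp n p"
    and cauchy: "\<And>e. e > 0 \<Longrightarrow> \<exists>J. \<forall>i\<ge>J. \<forall>j\<ge>J. Hnp_max_real_norm n p (\<lambda>z. \<sigma> i z - \<sigma> j z) < e"
  shows "\<exists>F\<in>Hnp n p. (\<lambda>j. Hnp_max_real_norm n p (\<lambda>z. \<sigma> j z - F z)) \<longlonglongrightarrow> 0"
proof -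
  have hol: "\<sigma> j holomorphic_on uhp" for j using mem by (simp add: Hnp_iff)
  have unif_cauchy: "uniformly_Cauchy_on {z. Im z > r} \<sigma>" if r: "r > 0" for r
    unfolding uniformly_Cauchy_on_def
  proof (intro allI impI)
    fix e :: real assume e: "e > 0"
    let ?K = "2 + 2 / r"
    have K: "?K > 0" using r by (simp add: add_pos_pos)
    obtain J where J: "\<And>i j. i \<ge> J \<Longrightarrow> j \<ge> J \<Longrightarrow> Hnp_max_real_norm n p (\<lambda>z. \<sigma> i z - \<sigma> j z) < e / ?K"
      using cauchy[of "e / ?K"] e K by auto
    have "dist (\<sigma> i z) (\<sigma> j z) < e" if "Im z > r" "i \<ge> J" "j \<ge> J" for z i j
    proof -
      have "dist (\<sigma> i z) (\<sigma> j z) \<le> ?K * Hnp_max_real_norm n p (\<lambda>z. \<sigma> i z - \<sigma> j z)"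
        unfolding dist_norm by (intro cmod_le_Hnp_norm p Hnp_diff mem r that)
      also have "\<dots> < ?K * (e / ?K)"
        using K J[OF that(2,3)] by (intro mult_strict_left_mono)
      finally show ?thesis using K by simp
    qed
    then show "\<exists>M. \<forall>x\<in>{z. r < Im z}. \<forall>m\<ge>M. \<forall>n\<ge>M. dist (\<sigma> m x) (\<sigma> n x) < e"
      by auto
  qed
  define F where "F z = (if z \<in> uhp then lim (\<lambda>j. \<sigma> j z) else 0)" for z
  have unif_lim: "uniform_limit {z. Im z > r} \<sigma> F sequentially" if "r > 0" for r
  proof -
    have "uniform_limit {z. Im z > r} \<sigma> (\<lambda>z. lim (\<lambda>j. \<sigma> j z)) sequentially"
      using Cauchy_uniformly_convergent[OF unif_cauchy[OF that]]
      by (simp add: uniformly_convergent_uniform_limit_iff)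
    then show ?thesis
      by (rule uniform_limit_cong'[THEN iffD1, rotated 2]) (use that in \<open>auto simp: F_def uhp_def\<close>)
  qed
  have half_open: "open {z. Im z > r}" for r :: real
    by (rule open_halfspace_Im_gt)
  have half_sub: "{z. Im z > r} \<subseteq> uhp" if "r > 0" for r
    using that by (auto simp: uhp_def)
  have F_hol: "F holomorphic_on uhp"
  proof (rule holomorphic_uniform_sequence[OF open_uhp hol])
    fix z assume z: "z \<in> uhp"
    define r where "r = Im z / 2"
    have r: "r > 0" "z \<in> {z. Im z > r}" using z by (auto simp: r_def uhp_def)
    then obtain e where e: "e > 0" "cball z e \<subseteq> {z. Im z > r}"
      using half_open[of r] by (metis open_contains_cball)
    then show "\<exists>d>0. cball z d \<subseteq> uhp \<and> uniform_limit (cball z d) \<sigma> F sequentially"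
      using half_sub[OF r(1)] uniform_limit_on_subset[OF unif_lim[OF r(1)]] by blast
  qed
  have deriv_lim: "(\<lambda>j. uhp_deriv k (\<sigma> j) z) \<longlonglongrightarrow> uhp_deriv k F z" if z: "z \<in> uhp" for k z
  proof -
    define r where "r = Im z / 2"
    have r: "r > 0" "z \<in> {z. Im z > r}" using z by (auto simp: r_def uhp_def)
    have "(\<lambda>j. (deriv ^^ k) (\<sigma> j) z) \<longlonglongrightarrow> (deriv ^^ k) F z"
      using r half_sub[OF r(1)] half_open[of r] unif_lim[OF r(1)] hol
      by (intro higher_deriv_complex_uniform_limit[where A = "{z. Im z > r}"])
        (auto intro!: always_eventually holomorphic_on_subset[OF hol])
    then show ?thesis using z by (simp add: uhp_deriv_def)
  qed
  have tail: "Hnp_max_norm n p (\<lambda>z. \<sigma> j z - F z) \<le> ennreal e"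
    if e: "e > 0" and J: "\<And>i j. i \<ge> J \<Longrightarrow> j \<ge> J \<Longrightarrow> Hnp_max_real_norm n p (\<lambda>z. \<sigma> i z - \<sigma> j z) < e"
      and j: "j \<ge> J" for e J j
  proof (rule Hnp_max_norm_le_pointwise_limit[OF p, where G = "\<lambda>i z. \<sigma> j z - \<sigma> (i + J) z"])
    show "(\<lambda>z. \<sigma> j z - \<sigma> (i + J) z) holomorphic_on uhp" for i
      by (intro holomorphic_intros hol)
    show "(\<lambda>i. uhp_deriv k (\<lambda>z. \<sigma> j z - \<sigma> (i + J) z) z) \<longlonglongrightarrow> uhp_deriv k (\<lambda>z. \<sigma> j z - F z) z"
      if "z \<in> uhp" for k z
      unfolding uhp_deriv_diff[OF hol hol] uhp_deriv_diff[OF hol F_hol]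
      by (intro tendsto_intros LIMSEQ_ignore_initial_segment[of "\<lambda>i. uhp_deriv k (\<sigma> i) z"] deriv_lim that)
    show "Hnp_max_norm n p (\<lambda>z. \<sigma> j z - \<sigma> (i + J) z) \<le> ennreal e" for i
      using J[of j "i + J"] j Hnp_max_norm_eq[OF Hnp_diff[OF p mem mem]]
      by (simp add: ennreal_leI)
  qed (use e in simp)
  have F_mem: "F \<in> Hnp n p"
  proof -
    obtain J where J: "\<And>i j. i \<ge> J \<Longrightarrow> j \<ge> J \<Longrightarrow> Hnp_max_real_norm n p (\<lambda>z. \<sigma> i z - \<sigma> j z) < 1"
      using cauchy[of 1] by auto
    have "Hnp_max_norm n p (\<lambda>z. \<sigma> J z - F z) < \<infinity>"
      using tail[of 1 J J] J le_less_trans[of _ "ennreal 1" \<infinity>] by fastforce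
    then have "(\<lambda>z. \<sigma> J z - F z) \<in> Hnp n p"
      using mem[of J] F_hol by (auto simp: Hnp_iff F_def[abs_def] intro: holomorphic_on_diff)
    then have "(\<lambda>z. \<sigma> J z - (\<sigma> J z - F z)) \<in> Hnp n p"
      by (rule Hnp_diff[OF p mem])
    then show ?thesis by simp
  qed
  have "(\<lambda>j. Hnp_max_real_norm n p (\<lambda>z. \<sigma> j z - F z)) \<longlonglongrightarrow> 0"
  proof (rule LIMSEQ_I)
    fix e :: real assume e: "e > 0"
    then obtain J where J: "\<And>i j. i \<ge> J \<Longrightarrow> j \<ge> J \<Longrightarrow> Hnp_max_real_norm n p (\<lambda>z. \<sigma> i z - \<sigma> j z) < e / 2"
      using cauchy[of "e / 2"] by auto
    have "Hnp_max_real_norm n p (\<lambda>z. \<sigma> j z - F z) \<le> e / 2" if "j \<ge> J" for j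
      using tail[of "e / 2" J j] J e that by (intro Hnp_max_real_norm_le) auto
    then show "\<exists>J. \<forall>j\<ge>J. norm (Hnp_max_real_norm n p (\<lambda>z. \<sigma> j z - F z) - 0) < e"
      using e Hnp_max_real_norm_nonneg by (intro exI[of _ J]) fastforce
  qed
  with F_mem show ?thesis by blast
qed

text \<open>
  Norm convergence implies pointwise convergence of the derivatives up to order \<open>n\<close>, which the Leibniz rule
  transfers to the products with \<open>\<psi>\<close>.  By Fatou's lemma \<open>F \<mapsto> \<parallel>\<psi> F\<parallel>\<close> is therefore lower
  semicontinuous, and the Baire argument applies.
\<close>
lemma mult_op_bounded:
  assumes p: "1 \<le> p" and \<psi>: "\<psi> \<in> multipliers n p"
  shows "\<exists>C\<ge>0. \<forall>F\<in>Hnp n p. Hnp_max_real_norm n p (mult_op \<psi> F) \<le> C * Hnp_max_real_norm n p F"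
proof -
  let ?N = "Hnp_max_real_norm n p"
  have hol: "\<psi> holomorphic_on uhp" and mult: "\<And>F. F \<in> Hnp n p \<Longrightarrow> mult_op \<psi> F \<in> Hnp n p"
    using \<psi> by (auto simp: multipliers_def)
  have deriv_lim: "(\<lambda>j. uhp_deriv k (\<sigma> j) z) \<longlonglongrightarrow> uhp_deriv k F z"
    if mem: "\<And>j. \<sigma> j \<in> Hnp n p" "F \<in> Hnp n p" and lim: "(\<lambda>j. ?N (\<lambda>z. \<sigma> j z - F z)) \<longlonglongrightarrow> 0"
      and z: "z \<in> uhp" and k: "k \<le> n" for \<sigma> F z k
  proof -
    have r: "Im z / 2 > 0" "Im z / 2 < Im z" using z by (auto simp: uhp_def)
    have "(\<lambda>j. uhp_deriv k (\<sigma> j) z - uhp_deriv k F z) \<longlonglongrightarrow> 0"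
    proof (rule Lim_null_comparison[OF always_eventually])
      show "\<forall>j. norm (uhp_deriv k (\<sigma> j) z - uhp_deriv k F z) \<le> (2 + 2 / (Im z / 2)) * ?N (\<lambda>z. \<sigma> j z - F z)"
        using cmod_uhp_deriv_le[OF p Hnp_diff[OF p mem(1,2)] k r] mem
        by (simp add: uhp_deriv_diff Hnp_iff)
      show "(\<lambda>j. (2 + 2 / (Im z / 2)) * ?N (\<lambda>z. \<sigma> j z - F z)) \<longlonglongrightarrow> 0"
        using lim by (intro tendsto_mult_right_zero)
    qed
    then show ?thesis by (simp add: LIM_zero_iff)
  qed
  show ?thesis
  proof (rule lower_semicontinuous_seminorm_bounded[where s = "\<lambda>F. ?N (mult_op \<psi> F)"])
    show "(\<lambda>z. F z + G z) \<in> Hnp n p" if "F \<in> Hnp n p" "G \<in> Hnp n p" for F G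
      using that by (rule Hnp_add[OF p])
    show "(\<lambda>z. c * F z) \<in> Hnp n p" if "F \<in> Hnp n p" for F c
      using that by (rule Hnp_cmult[OF p])
    have "Hnp_max_norm n p (\<lambda>z. 0) \<le> 0"
      using Hnp_max_norm_cmult[OF p, of "\<lambda>z. 0" n 0] by simp
    then have zero: "(\<lambda>z. 0) \<in> Hnp n p" "?N (\<lambda>z. 0) = 0"
      by (auto simp: Hnp_iff Hnp_max_real_norm_def)
    then show "Hnp n p \<noteq> {}" by blast
    show "?N F = 0 \<longleftrightarrow> F = (\<lambda>z. 0)" if F: "F \<in> Hnp n p" for F
    proof
      assume "?N F = 0"
      then have "F z = 0" for z
        using cmod_le_Hnp_norm[OF p F, of "Im z / 2" z] F by (cases "z \<in> uhp") (auto simp: uhp_def Hnp_iff)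
      then show "F = (\<lambda>z. 0)" by blast
    qed (use zero in simp)
    show "?N (\<lambda>z. F z + G z) \<le> ?N F + ?N G" if "F \<in> Hnp n p" "G \<in> Hnp n p" for F G
      using that by (rule Hnp_max_real_norm_add[OF p])
    show "?N (\<lambda>z. c * F z) \<le> cmod c * ?N F" if "F \<in> Hnp n p" for F c
      using that by (rule Hnp_max_real_norm_cmult[OF p])
    show "\<exists>F\<in>Hnp n p. (\<lambda>j. ?N (\<lambda>z. \<sigma> j z - F z)) \<longlonglongrightarrow> 0"
      if "range \<sigma> \<subseteq> Hnp n p" "\<And>e. e > 0 \<Longrightarrow> \<exists>J. \<forall>i\<ge>J. \<forall>j\<ge>J. ?N (\<lambda>z. \<sigma> i z - \<sigma> j z) < e" for \<sigma>
      using that by (intro Hnp_complete p) auto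
    show "?N (mult_op \<psi> (\<lambda>z. F z + G z)) \<le> ?N (mult_op \<psi> F) + ?N (mult_op \<psi> G)"
      if "F \<in> Hnp n p" "G \<in> Hnp n p" for F G
      using Hnp_max_real_norm_add[OF p mult[OF that(1)] mult[OF that(2)]]
      by (simp add: mult_op_def distrib_left)
    show "?N (mult_op \<psi> (\<lambda>z. c * F z)) \<le> cmod c * ?N (mult_op \<psi> F)" if "F \<in> Hnp n p" for F c
      using Hnp_max_real_norm_cmult[OF p mult[OF that], of c]
      by (simp add: mult_op_def mult.left_commute)
    show "?N (mult_op \<psi> F) \<le> real m"
      if sub: "range \<sigma> \<subseteq> Hnp n p" and F: "F \<in> Hnp n p" and lim: "(\<lambda>j. ?N (\<lambda>z. \<sigma> j z - F z)) \<longlonglongrightarrow> 0"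
        and bound: "\<And>j. ?N (mult_op \<psi> (\<sigma> j)) \<le> real m" for \<sigma> F m
    proof (rule Hnp_max_real_norm_le[OF Hnp_max_norm_le_pointwise_limit[OF p, where G = "\<lambda>j. mult_op \<psi> (\<sigma> j)"]])
      have mem: "\<sigma> j \<in> Hnp n p" for j using sub by auto
      show "mult_op \<psi> (\<sigma> j) holomorphic_on uhp" for j
        using mult[OF mem] by (simp add: Hnp_iff)
      show "Hnp_max_norm n p (mult_op \<psi> (\<sigma> j)) \<le> ennreal (real m)" for j
        using bound[of j] Hnp_max_norm_eq[OF mult[OF mem[of j]]] by (simp add: ennreal_leI)
      have leibniz: "uhp_deriv k (mult_op \<psi> G) z
          = (\<Sum>i=0..k. of_nat (k choose i) * uhp_deriv i \<psi> z * uhp_deriv (k - i) G z)"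
        if "G \<in> Hnp n p" "z \<in> uhp" for k z G
        using higher_deriv_mult[OF hol _ open_uhp, of G z k] that
        by (simp add: uhp_deriv_def mult_op_def Hnp_iff)
      show "(\<lambda>j. uhp_deriv k (mult_op \<psi> (\<sigma> j)) z) \<longlonglongrightarrow> uhp_deriv k (mult_op \<psi> F) z"
        if "k \<le> n" "z \<in> uhp" for k z
        unfolding leibniz[OF mem that(2)] leibniz[OF F that(2)]
        using that by (intro tendsto_intros deriv_lim[OF mem F lim]) auto
    qed auto
  qed (rule Hnp_max_real_norm_nonneg)
qed

section \<open>Division by a multiplier that is bounded away from zero\<close>

lemma higher_deriv_power_mult_eq_0:
  fixes f h :: "complex \<Rightarrow> complex"
  assumes f: "f holomorphic_on S" and h: "h holomorphic_on S" and S: "open S" "z \<in> S"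
    and zero: "f z = 0" and "k < m"
  shows "(deriv ^^ k) (\<lambda>w. f w ^ m * h w) z = 0"
  using \<open>k < m\<close>
proof (induction m arbitrary: k)
  case (Suc m)
  have "(deriv ^^ k) (\<lambda>w. f w * (f w ^ m * h w)) z
      = (\<Sum>i=0..k. of_nat (k choose i) * (deriv ^^ i) f z * (deriv ^^ (k - i)) (\<lambda>w. f w ^ m * h w) z)"
    by (intro higher_deriv_mult[OF f _ S] holomorphic_intros f h)
  also have "\<dots> = 0"
  proof (intro sum.neutral ballI)
    fix i assume "i \<in> {0..k}"
    then show "of_nat (k choose i) * (deriv ^^ i) f z * (deriv ^^ (k - i)) (\<lambda>w. f w ^ m * h w) z = 0"
      using zero Suc.IH[of "k - i"] Suc.prems by (cases "i = 0") auto
  qed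
  finally show ?case by (simp add: mult.assoc)
qed simp

lemma higher_deriv_sum:
  fixes f :: "'i \<Rightarrow> complex \<Rightarrow> complex"
  assumes "\<And>i. i \<in> I \<Longrightarrow> f i holomorphic_on S" "open S" "z \<in> S"
  shows "(deriv ^^ k) (\<lambda>w. \<Sum>i\<in>I. f i w) z = (\<Sum>i\<in>I. (deriv ^^ k) (f i) z)"
  using assms(1)
proof (induction I rule: infinite_finite_induct)
  case (insert i I)
  then show ?case
    using higher_deriv_add[of "f i" S "\<lambda>w. \<Sum>i\<in>I. f i w" z k] assms(2,3)
    by (simp add: holomorphic_on_sum)
qed (simp_all add: higher_deriv_const)

lemma one_minus_power_Suc:
  fixes x :: "'a::comm_ring_1"
  shows "1 - (1 - x) ^ Suc n = (\<Sum>i\<le>n. (-1) ^ i * of_nat (Suc n choose Suc i) * x ^ Suc i)"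
proof -
  have "(1 - x) ^ Suc n = (\<Sum>i\<le>Suc n. of_nat (Suc n choose i) * (- x) ^ i)"
    using binomial_ring[of "- x" 1 "Suc n"] by simp
  also have "\<dots> = 1 + (\<Sum>i\<le>n. of_nat (Suc n choose Suc i) * (- x) ^ Suc i)"
    by (subst sum.atMost_Suc_shift) simp
  also have "(\<Sum>i\<le>n. of_nat (Suc n choose Suc i) * (- x) ^ Suc i)
      = - (\<Sum>i\<le>n. (-1) ^ i * of_nat (Suc n choose Suc i) * x ^ Suc i)"
    unfolding sum_negf[symmetric]
    by (intro sum.cong refl) (simp add: power_minus[of x "Suc _"] power_minus[of x] mult_ac)
  finally show ?thesis by simp
qed

text \<open>
  With \<open>x = \<phi> / \<phi> z\<close>, the polynomial \<open>(1 - (1 - x)\<^bsup>n+1\<^esup>) / x\<close> in \<open>x\<close> agrees with \<open>1 / x\<close> up to a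
  multiple of \<open>(1 - x)\<^bsup>n+1\<^esup>\<close>, whose derivatives of order at most \<open>n\<close> vanish at \<open>z\<close>.
  In contrast to the quotient rule, no derivative of \<open>\<phi>\<close> appears on its own.
\<close>
lemma higher_deriv_divide:
  fixes F \<phi> :: "complex \<Rightarrow> complex"
  assumes F: "F holomorphic_on S" and \<phi>: "\<phi> holomorphic_on S" and nz: "\<And>w. w \<in> S \<Longrightarrow> \<phi> w \<noteq> 0"
    and S: "open S" "z \<in> S" and k: "k \<le> n"
  shows "(deriv ^^ k) (\<lambda>w. F w / \<phi> w) z
      = (\<Sum>i\<le>n. (-1) ^ i * of_nat (Suc n choose Suc i) / \<phi> z ^ Suc i * (deriv ^^ k) (\<lambda>w. \<phi> w ^ i * F w) z)"
proof -
  define c where "c = \<phi> z"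
  have c: "c \<noteq> 0" using nz S by (simp add: c_def)
  define a where "a i = (-1) ^ i * of_nat (Suc n choose Suc i) / c ^ Suc i" for i
  let ?G = "\<lambda>i w. a i * (\<phi> w ^ i * F w)"
  let ?R = "\<lambda>w. (1 - \<phi> w / c) ^ Suc n * (F w / \<phi> w)"
  have hol_G: "?G i holomorphic_on S" for i
    by (intro holomorphic_intros F \<phi>)
  have hol_sum: "(\<lambda>w. \<Sum>i\<le>n. ?G i w) holomorphic_on S"
    by (intro holomorphic_on_sum hol_G)
  have hol_R: "?R holomorphic_on S"
    using c nz by (intro holomorphic_intros F \<phi>) auto
  have split: "F w / \<phi> w = (\<Sum>i\<le>n. ?G i w) + ?R w" if w: "w \<in> S" for w
  proof -
    have "(\<Sum>i\<le>n. ?G i w) = (\<Sum>i\<le>n. (-1) ^ i * of_nat (Suc n choose Suc i) * (\<phi> w / c) ^ Suc i) * (F w / \<phi> w)"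
      unfolding sum_distrib_right using nz[OF w]
      by (intro sum.cong refl) (simp add: a_def power_divide)
    also have "\<dots> = (1 - (1 - \<phi> w / c) ^ Suc n) * (F w / \<phi> w)"
      by (simp only: one_minus_power_Suc)
    finally show ?thesis by (simp only: left_diff_distrib) simp
  qed
  have "(deriv ^^ k) (\<lambda>w. F w / \<phi> w) z = (deriv ^^ k) (\<lambda>w. (\<Sum>i\<le>n. ?G i w) + ?R w) z"
    using nz by (intro higher_deriv_transform_within_open[OF _ _ S] holomorphic_on_add holomorphic_on_divide hol_sum hol_R F \<phi> split) auto
  also have "\<dots> = (deriv ^^ k) (\<lambda>w. \<Sum>i\<le>n. ?G i w) z + (deriv ^^ k) ?R z"
    by (rule higher_deriv_add[OF hol_sum hol_R S])
  also have "(deriv ^^ k) ?R z = 0"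
    using c nz k
    by (intro higher_deriv_power_mult_eq_0[OF _ _ S] holomorphic_intros F \<phi>) (auto simp: c_def)
  also have "(deriv ^^ k) (\<lambda>w. \<Sum>i\<le>n. ?G i w) z = (\<Sum>i\<le>n. (deriv ^^ k) (?G i) z)"
    by (rule higher_deriv_sum[OF hol_G S])
  also have "\<dots> = (\<Sum>i\<le>n. a i * (deriv ^^ k) (\<lambda>w. \<phi> w ^ i * F w) z)"
    by (intro sum.cong refl higher_deriv_cmult[OF _ S(2,1)] holomorphic_intros F \<phi>)
  finally show ?thesis by (simp add: a_def c_def)
qed

lemma Hp_norm_sum:
  assumes p: "1 \<le> p" and I: "finite I" "I \<noteq> {}" and cont: "\<And>i. i \<in> I \<Longrightarrow> continuous_on uhp (f i)"
  shows "Hp_norm p (\<lambda>z. \<Sum>i\<in>I. f i z) \<le> (\<Sum>i\<in>I. Hp_norm p (f i))"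
  using I cont
proof (induction I rule: finite_ne_induct)
  case (insert i I)
  have "Hp_norm p (\<lambda>z. \<Sum>j\<in>insert i I. f j z) = Hp_norm p (\<lambda>z. f i z + (\<Sum>j\<in>I. f j z))"
    using insert by simp
  also have "\<dots> \<le> Hp_norm p (f i) + Hp_norm p (\<lambda>z. \<Sum>j\<in>I. f j z)"
    using insert by (intro Hp_norm_triangle p continuous_on_sum) auto
  also have "\<dots> \<le> Hp_norm p (f i) + (\<Sum>j\<in>I. Hp_norm p (f j))"
    using insert by (intro add_left_mono) auto
  finally show ?case using insert by simp
qed simp

text \<open>
  In \<open>higher_deriv_divide\<close> the coefficients are at most \<open>binom(n+1, i+1) / \<delta>\<^bsup>i+1\<^esup>\<close> in modulus, and
  \<open>\<phi>\<^sup>i F\<close> has norm at most \<open>C\<^sup>i \<parallel>F\<parallel>\<close>, where \<open>C\<close> bounds the multiplication by \<open>\<phi>\<close>.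
\<close>
lemma Hnp_divide:
  assumes p: "1 \<le> p" and \<phi>: "\<phi> \<in> multipliers n p"
    and \<delta>: "\<delta> > 0" and lower: "\<And>z. z \<in> uhp \<Longrightarrow> \<delta> \<le> cmod (\<phi> z)"
  shows "\<exists>K\<ge>0. \<forall>F\<in>Hnp n p. (\<lambda>z. F z / \<phi> z) \<in> Hnp n p \<and>
    Hnp_max_norm n p (\<lambda>z. F z / \<phi> z) \<le> ennreal K * Hnp_max_norm n p F"
proof -
  have hol: "\<phi> holomorphic_on uhp" and mult: "\<And>F. F \<in> Hnp n p \<Longrightarrow> mult_op \<phi> F \<in> Hnp n p"
    using \<phi> by (auto simp: multipliers_def)
  have nz: "\<phi> z \<noteq> 0" if "z \<in> uhp" for z using lower[OF that] \<delta> by auto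
  obtain C where C: "C \<ge> 0"
    "\<And>F. F \<in> Hnp n p \<Longrightarrow> Hnp_max_real_norm n p (mult_op \<phi> F) \<le> C * Hnp_max_real_norm n p F"
    using mult_op_bounded[OF p \<phi>] by blast
  have power: "(\<lambda>z. \<phi> z ^ i * F z) \<in> Hnp n p \<and>
      Hnp_max_real_norm n p (\<lambda>z. \<phi> z ^ i * F z) \<le> C ^ i * Hnp_max_real_norm n p F"
    if F: "F \<in> Hnp n p" for F i
  proof (induction i)
    case (Suc i)
    have "(\<lambda>z. \<phi> z ^ Suc i * F z) = mult_op \<phi> (\<lambda>z. \<phi> z ^ i * F z)"
      by (simp add: mult_op_def mult.assoc)
    moreover have "Hnp_max_real_norm n p (mult_op \<phi> (\<lambda>z. \<phi> z ^ i * F z))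
        \<le> C * (C ^ i * Hnp_max_real_norm n p F)"
      using Suc C by (meson mult_left_mono order.trans)
    ultimately show ?case
      using mult Suc by (simp add: mult.assoc)
  qed (use F in simp)
  define b where "b i = real (Suc n choose Suc i) / \<delta> ^ Suc i" for i
  have b: "b i \<ge> 0" for i using \<delta> by (simp add: b_def)
  define K where "K = (\<Sum>i\<le>n. b i * C ^ i)"
  have K: "K \<ge> 0" using b C by (simp add: K_def sum_nonneg)
  have main: "(\<lambda>z. F z / \<phi> z) \<in> Hnp n p \<and> Hnp_max_norm n p (\<lambda>z. F z / \<phi> z) \<le> ennreal K * Hnp_max_norm n p F"
    if F: "F \<in> Hnp n p" for F
  proof -
    let ?N = "Hnp_max_real_norm n p F"
    have F_hol: "F holomorphic_on uhp" using F by (simp add: Hnp_iff)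
    have hol_div: "(\<lambda>z. F z / \<phi> z) holomorphic_on uhp"
      using nz by (intro holomorphic_intros F_hol hol)
    have bound: "Hnp_max_norm n p (\<lambda>z. F z / \<phi> z) \<le> ennreal (K * ?N)"
      unfolding Hnp_max_norm_le_iff
    proof (intro allI impI)
      fix k assume k: "k \<le> n"
      let ?D = "\<lambda>i. uhp_deriv k (\<lambda>w. \<phi> w ^ i * F w)"
      let ?G = "\<lambda>i z. (-1) ^ i * of_nat (Suc n choose Suc i) / \<phi> z ^ Suc i * ?D i z"
      have hol_pow: "(\<lambda>w. \<phi> w ^ i * F w) holomorphic_on uhp" for i
        by (intro holomorphic_intros hol F_hol)
      have cont_G: "continuous_on uhp (?G i)" for i
        using nz by (intro continuous_intros uhp_deriv_continuous hol_pow holomorphic_on_imp_continuous_on[OF hol]) auto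
      have eq: "uhp_deriv k (\<lambda>z. F z / \<phi> z) z = (\<Sum>i\<le>n. ?G i z)" if "z \<in> uhp" for z
        using higher_deriv_divide[OF F_hol hol nz open_uhp that k] that by (simp add: uhp_deriv_def)
      have "Hp_norm p (uhp_deriv k (\<lambda>z. F z / \<phi> z)) \<le> Hp_norm p (\<lambda>z. \<Sum>i\<le>n. ?G i z)"
        by (intro Hp_norm_mono p) (simp add: eq)
      also have "\<dots> \<le> (\<Sum>i\<le>n. Hp_norm p (?G i))"
        by (intro Hp_norm_sum p cont_G) auto
      also have "\<dots> \<le> (\<Sum>i\<le>n. ennreal (b i * C ^ i * ?N))"
      proof (intro sum_mono)
        fix i
        have "Hp_norm p (?G i) \<le> Hp_norm p (\<lambda>z. of_real (b i) * ?D i z)"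
        proof (intro Hp_norm_mono p)
          fix z assume z: "z \<in> uhp"
          then have "\<delta> ^ Suc i \<le> cmod (\<phi> z) ^ Suc i"
            using lower \<delta> by (intro power_mono) auto
          then have "real (Suc n choose Suc i) / cmod (\<phi> z) ^ Suc i \<le> b i"
            unfolding b_def using \<delta> nz[OF z] by (intro divide_left_mono mult_pos_pos) auto
          then have "real (Suc n choose Suc i) / cmod (\<phi> z) ^ Suc i * cmod (?D i z) \<le> b i * cmod (?D i z)"
            by (rule mult_right_mono) simp
          then show "cmod (?G i z) \<le> cmod (of_real (b i) * ?D i z)"
            using b[of i] by (simp add: norm_mult norm_divide norm_power del: binomial_Suc_Suc power_Suc)
        qed
        also have "\<dots> \<le> ennreal (b i) * Hp_norm p (?D i)"
          using Hp_norm_cmult_le[OF p uhp_deriv_continuous[OF hol_pow], of "of_real (b i)"] b[of i] by simp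
        also have "\<dots> \<le> ennreal (b i) * ennreal (C ^ i * ?N)"
        proof (intro mult_left_mono)
          have "Hp_norm p (?D i) \<le> Hnp_max_norm n p (\<lambda>w. \<phi> w ^ i * F w)"
            by (rule Hp_norm_uhp_deriv_le[OF k])
          also have "\<dots> = ennreal (Hnp_max_real_norm n p (\<lambda>w. \<phi> w ^ i * F w))"
            using power[OF F] by (intro Hnp_max_norm_eq) simp
          also have "\<dots> \<le> ennreal (C ^ i * ?N)"
            using power[OF F] by (intro ennreal_leI) simp
          finally show "Hp_norm p (?D i) \<le> ennreal (C ^ i * ?N)" .
        qed simp
        also have "\<dots> = ennreal (b i * C ^ i * ?N)"
          using b[of i] by (simp add: ennreal_mult' mult.assoc)
        finally show "Hp_norm p (?G i) \<le> ennreal (b i * C ^ i * ?N)" .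
      qed
      also have "\<dots> = ennreal (\<Sum>i\<le>n. b i * C ^ i * ?N)"
        using b C Hnp_max_real_norm_nonneg by (intro sum_ennreal) simp
      also have "\<dots> = ennreal (K * ?N)"
        by (simp add: K_def sum_distrib_right)
      finally show "Hp_norm p (uhp_deriv k (\<lambda>z. F z / \<phi> z)) \<le> ennreal (K * ?N)" .
    qed
    have "Hnp_max_norm n p (\<lambda>z. F z / \<phi> z) < \<infinity>"
      using bound by (rule le_less_trans) simp
    moreover have "ennreal (K * ?N) = ennreal K * Hnp_max_norm n p F"
      using K by (simp add: Hnp_max_norm_eq[OF F] ennreal_mult')
    ultimately show ?thesis
      using bound hol_div F by (auto simp: Hnp_iff)
  qed
  then show ?thesis using K by blast
qed

section \<open>A member of the space without zeros\<close>

lemma nn_integral_inverse_1_plus_square_finite: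
  "(\<integral>\<^sup>+ x. ennreal (inverse (1 + x\<^sup>2)) \<partial>lborel) < \<infinity>"
proof -
  have "integrable lborel (\<lambda>x::real. inverse (1 + x\<^sup>2))"
    using integrable_inverse_1_plus_square by (simp add: set_integrable_def)
  then have "(\<integral>\<^sup>+ x. ennreal (norm (inverse (1 + x\<^sup>2 :: real))) \<partial>lborel) < \<infinity>"
    by (simp add: integrable_iff_bounded)
  moreover have "norm (inverse (1 + x\<^sup>2)) = inverse (1 + x\<^sup>2)" for x :: real
    by (simp add: add_nonneg_nonneg)
  ultimately show ?thesis by simp
qed

lemma cmod_plus_i_ge:
  assumes "z \<in> uhp"
  shows "1 + (Re z)\<^sup>2 \<le> (cmod (z + \<i>))\<^sup>2"
proof -
  have "1 \<le> (Im z + 1)\<^sup>2"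
    using assms by (simp add: uhp_def one_le_power)
  then show ?thesis by (simp add: cmod_power2)
qed

lemma Hp_norm_inverse_square_finite:
  assumes p: "1 \<le> p"
  shows "Hp_norm p (\<lambda>z. 1 / (z + \<i>)\<^sup>2) < \<infinity>"
proof -
  have le: "cmod (1 / (z + \<i>)\<^sup>2) \<le> inverse (1 + (Re z)\<^sup>2)" if "z \<in> uhp" for z
    using cmod_plus_i_ge[OF that]
    by (simp add: norm_divide norm_power inverse_eq_divide frac_le add_pos_nonneg)
  have le1: "inverse (1 + x\<^sup>2) \<le> 1" for x :: real
    by (simp add: inverse_le_1_iff)
  show ?thesis
  proof (cases "p = \<infinity>")
    case True
    have "Hp_norm \<infinity> (\<lambda>z. 1 / (z + \<i>)\<^sup>2) \<le> ennreal 1"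
      using le le1 by (subst Hp_norm_infinity_le_iff) (auto intro: order.trans)
    then show ?thesis using True le_less_trans[of _ "ennreal 1" \<infinity>] by auto
  next
    case False
    have q: "enn2real p \<ge> 1" by (rule one_le_enn2real[OF p False])
    obtain a where a: "(\<integral>\<^sup>+ x. ennreal (inverse (1 + x\<^sup>2)) \<partial>lborel) = ennreal a" "a \<ge> 0"
      using nn_integral_inverse_1_plus_square_finite
      by (cases "\<integral>\<^sup>+ x. ennreal (inverse (1 + x\<^sup>2)) \<partial>lborel") auto
    have "Hp_norm p (\<lambda>z. 1 / (z + \<i>)\<^sup>2) \<le> ennreal (max 1 a)"
    proof (rule Hp_norm_le_iff[OF p False, THEN iffD2, rule_format])
      fix y :: real assume y: "y > 0"
      have "(\<integral>\<^sup>+ x. ennreal (cmod (1 / (Complex x y + \<i>)\<^sup>2) powr enn2real p) \<partial>lborel)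
          \<le> (\<integral>\<^sup>+ x. ennreal (inverse (1 + x\<^sup>2)) \<partial>lborel)"
      proof (intro nn_integral_mono ennreal_leI)
        fix x
        let ?u = "cmod (1 / (Complex x y + \<i>)\<^sup>2)"
        have u: "?u \<le> inverse (1 + x\<^sup>2)"
          using le[of "Complex x y"] y by (simp add: uhp_def)
        then have "?u powr enn2real p \<le> ?u powr 1"
          using q le1[of x] by (intro powr_mono') auto
        then show "?u powr enn2real p \<le> inverse (1 + x\<^sup>2)"
          using u by simp
      qed
      also have "\<dots> \<le> ennreal (max 1 a powr 1)"
        using a by (simp add: ennreal_leI)
      also have "\<dots> \<le> ennreal (max 1 a powr enn2real p)"
        using q by (intro ennreal_leI powr_mono) auto
      finally show "(\<integral>\<^sup>+ x. ennreal (cmod (1 / (Complex x y + \<i>)\<^sup>2) powr enn2real p) \<partial>lborel)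
          \<le> ennreal (max 1 a powr enn2real p)" .
    qed simp
    then show ?thesis by (rule le_less_trans) simp
  qed
qed

lemma higher_deriv_inverse_square:
  assumes "z \<in> uhp"
  shows "(deriv ^^ k) (\<lambda>z. 1 / (z + \<i>)\<^sup>2) z = (-1) ^ k * fact (Suc k) / (z + \<i>) ^ (k + 2)"
  using assms
proof (induction k arbitrary: z)
  case (Suc k)
  have nz: "z + \<i> \<noteq> 0"
    using Suc.prems by (auto simp: uhp_def complex_eq_iff)
  have "(deriv ^^ Suc k) (\<lambda>z. 1 / (z + \<i>)\<^sup>2) z = deriv (\<lambda>z. (-1) ^ k * fact (Suc k) / (z + \<i>) ^ (k + 2)) z"
    unfolding funpow.simps o_apply
    by (intro deriv_cong_ev refl eventually_mono[OF eventually_nhds_in_open[OF open_uhp Suc.prems]] Suc.IH)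
  also have "\<dots> = (-1) ^ Suc k * fact (Suc (Suc k)) / (z + \<i>) ^ (Suc k + 2)"
  proof (rule DERIV_imp_deriv)
    have "((\<lambda>z. (z + \<i>) ^ (k + 2)) has_field_derivative of_nat (k + 2) * (z + \<i>) ^ (k + 1)) (at z)"
      by (rule derivative_eq_intros refl)+ simp
    from DERIV_divide[OF DERIV_const this]
    have "((\<lambda>z. c / (z + \<i>) ^ (k + 2)) has_field_derivative - (c * of_nat (k + 2)) / (z + \<i>) ^ (Suc k + 2)) (at z)" for c
      using nz by simp
    from this[of "(-1) ^ k * fact (Suc k)"]
    show "((\<lambda>z. (-1) ^ k * fact (Suc k) / (z + \<i>) ^ (k + 2)) has_field_derivative
        (-1) ^ Suc k * fact (Suc (Suc k)) / (z + \<i>) ^ (Suc k + 2)) (at z)"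
      by (rule DERIV_cong) (simp add: algebra_simps)
  qed
  finally show ?case .
qed (simp add: power2_eq_square)

text \<open>
  The witness is \<open>1 / (z + \<i>)\<^sup>2\<close>: since \<open>\<bar>z + \<i>\<bar> \<ge> 1\<close> on the half-plane, all its derivatives
  are dominated by multiples of it, and on each line it is dominated by \<open>1 / (1 + x\<^sup>2)\<close>.
\<close>
lemma Hnp_nowhere_zero:
  assumes p: "1 \<le> p"
  obtains F where "F \<in> Hnp n p" "\<And>z. z \<in> uhp \<Longrightarrow> F z \<noteq> 0"
proof
  define F where "F z = (if z \<in> uhp then 1 / (z + \<i>)\<^sup>2 else 0)" for z
  have nz: "z + \<i> \<noteq> 0" if "z \<in> uhp" for z
    using that by (auto simp: uhp_def complex_eq_iff)
  have hol0: "(\<lambda>z. 1 / (z + \<i>)\<^sup>2) holomorphic_on uhp"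
    using nz by (intro holomorphic_intros) auto
  have hol: "F holomorphic_on uhp"
    using hol0 by (rule holomorphic_transform) (simp add: F_def)
  have "Hp_norm p (uhp_deriv k F) < \<infinity>" for k
  proof -
    have "Hp_norm p (uhp_deriv k F) \<le> Hp_norm p (\<lambda>z. fact (Suc k) * (1 / (z + \<i>)\<^sup>2))"
    proof (rule Hp_norm_mono[OF p])
      fix z assume z: "z \<in> uhp"
      have "uhp_deriv k F z = (deriv ^^ k) (\<lambda>z. 1 / (z + \<i>)\<^sup>2) z"
        using higher_deriv_transform_within_open[OF hol hol0 open_uhp z] z by (simp add: uhp_deriv_def F_def)
      also have "\<dots> = (-1) ^ k * fact (Suc k) / (z + \<i>) ^ (k + 2)"
        by (rule higher_deriv_inverse_square[OF z])
      finally have "cmod (uhp_deriv k F z) = fact (Suc k) / cmod (z + \<i>) ^ (k + 2)"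
        by (simp add: norm_mult norm_divide norm_power del: fact_Suc)
      also have "\<dots> \<le> fact (Suc k) / cmod (z + \<i>) ^ 2"
      proof -
        have "1\<^sup>2 \<le> (cmod (z + \<i>))\<^sup>2"
          using cmod_plus_i_ge[OF z] zero_le_power2[of "Re z"] unfolding power_one by linarith
        then have "1 \<le> cmod (z + \<i>)"
          by (rule power2_le_imp_le) simp
        then show ?thesis
          using nz[OF z] by (intro divide_left_mono power_increasing mult_pos_pos) auto
      qed
      finally show "cmod (uhp_deriv k F z) \<le> cmod (fact (Suc k) * (1 / (z + \<i>)\<^sup>2))"
        by (simp add: norm_mult norm_divide norm_power del: fact_Suc)
    qed
    also have "\<dots> \<le> ennreal (cmod (fact (Suc k))) * Hp_norm p (\<lambda>z. 1 / (z + \<i>)\<^sup>2)"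
      by (intro Hp_norm_cmult_le p holomorphic_on_imp_continuous_on hol0)
    also have "\<dots> < \<infinity>"
      using Hp_norm_inverse_square_finite[OF p] by (simp add: ennreal_mult_less_top)
    finally show ?thesis .
  qed
  then have "uhp_deriv k F \<in> Hp p" for k
    using uhp_deriv_holomorphic[OF hol] by (simp add: Hp_def uhp_deriv_def)
  then show "F \<in> Hnp n p"
    using hol by (simp add: Hnp_def F_def)
  show "F z \<noteq> 0" if "z \<in> uhp" for z
    using nz[OF that] that by (simp add: F_def)
qed

section \<open>The spectrum\<close>

lemma multipliers_diff_const:
  assumes p: "1 \<le> p" and \<psi>: "\<psi> \<in> multipliers n p"
  shows "(\<lambda>z. \<psi> z - \<mu>) \<in> multipliers n p"
proof -
  have "mult_op (\<lambda>z. \<psi> z - \<mu>) F \<in> Hnp n p" if F: "F \<in> Hnp n p" for F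
    using Hnp_diff[OF p _ Hnp_cmult[OF p F], of "mult_op \<psi> F" \<mu>] F \<psi>
    by (simp add: multipliers_def mult_op_def left_diff_distrib)
  then show ?thesis
    using \<psi> by (auto simp: multipliers_def intro: holomorphic_on_diff)
qed

text \<open>
  An inverse operator \<open>S\<close> is division by \<open>\<psi> - \<mu>\<close>, and its iterates show that \<open>\<psi> - \<mu>\<close> cannot be
  smaller than \<open>1 / \<parallel>S\<parallel>\<close> anywhere: otherwise every \<open>F = (\<psi> - \<mu>)\<^sup>m S\<^sup>m F\<close> would vanish at such a point.
\<close>
lemma in_spectrum_if_in_closure:
  assumes p: "1 \<le> p" and \<psi>: "\<psi> \<in> multipliers n p" and \<mu>: "\<mu> \<in> closure (\<psi> ` uhp)"
  shows "\<mu> \<in> spectrum_on (Hnp n p) (Hnp_norm n p) (mult_op \<psi>)"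
proof (rule ccontr)
  assume "\<mu> \<notin> spectrum_on (Hnp n p) (Hnp_norm n p) (mult_op \<psi>)"
  then obtain S where S: "bounded_operator_on (Hnp n p) (Hnp_norm n p) S"
    and inv: "\<And>F. F \<in> Hnp n p \<Longrightarrow> (\<lambda>z. mult_op \<psi> (S F) z - \<mu> * S F z) = F"
    by (auto simp: spectrum_on_def)
  obtain C where C: "\<And>F. F \<in> Hnp n p \<Longrightarrow> Hnp_norm n p (S F) \<le> ennreal C * Hnp_norm n p F"
    using S unfolding bounded_operator_on_def by blast
  have S_mem: "S F \<in> Hnp n p" if "F \<in> Hnp n p" for F
    using S that by (auto simp: bounded_operator_on_def)
  \<comment> \<open>A negative \<open>C\<close> would make \<open>ennreal (C\<^sup>m)\<close> differ from \<open>(ennreal C)\<^sup>m\<close>; moreover \<open>1 / A\<close> must make sense.\<close>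
  define A where "A = max C 1"
  have A: "A \<ge> 1" "C \<le> A" by (auto simp: A_def)
  obtain F where F: "F \<in> Hnp n p" "\<And>z. z \<in> uhp \<Longrightarrow> F z \<noteq> 0"
    using Hnp_nowhere_zero[OF p] by blast
  have iter: "(S ^^ m) F \<in> Hnp n p \<and> Hnp_norm n p ((S ^^ m) F) \<le> ennreal (A ^ m) * Hnp_norm n p F
      \<and> (\<forall>z. F z = (\<psi> z - \<mu>) ^ m * (S ^^ m) F z)" for m
  proof (induction m)
    case (Suc m)
    let ?G = "(S ^^ m) F"
    have G: "?G \<in> Hnp n p" using Suc by blast
    have "Hnp_norm n p (S ?G) \<le> ennreal C * Hnp_norm n p ?G" by (rule C[OF G])
    also have "\<dots> \<le> ennreal A * (ennreal (A ^ m) * Hnp_norm n p F)"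
      using Suc A by (intro mult_mono ennreal_leI) auto
    also have "\<dots> = ennreal (A ^ Suc m) * Hnp_norm n p F"
      using A by (simp add: ennreal_mult mult.assoc)
    finally have "Hnp_norm n p (S ?G) \<le> ennreal (A ^ Suc m) * Hnp_norm n p F" .
    moreover have "F z = (\<psi> z - \<mu>) ^ Suc m * S ?G z" for z
    proof -
      have "?G z = (\<psi> z - \<mu>) * S ?G z"
        using fun_cong[OF inv[OF G], of z] by (simp add: mult_op_def left_diff_distrib)
      then show ?thesis using Suc by (simp add: mult_ac)
    qed
    ultimately show ?case using S_mem[OF G] unfolding funpow.simps o_apply by blast
  qed (use F(1) in simp)
  obtain B where B: "Hnp_norm n p F = ennreal B" "B \<ge> 0"
  proof -
    have "Hnp_norm n p F \<le> ennreal (real (Suc n)) * Hnp_max_norm n p F"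
      by (rule Hnp_norm_le_Hnp_max_norm[OF p])
    also have "\<dots> < \<infinity>" using F(1) by (simp add: Hnp_iff ennreal_mult_less_top del: of_nat_Suc)
    finally show ?thesis using that by (cases "Hnp_norm n p F") auto
  qed
  have far: "1 / A \<le> cmod (\<psi> w - \<mu>)" if w: "w \<in> uhp" for w
  proof (rule ccontr)
    assume "\<not> 1 / A \<le> cmod (\<psi> w - \<mu>)"
    then have x: "cmod (\<psi> w - \<mu>) * A < 1"
      using A by (simp add: field_simps)
    have r: "Im w / 2 > 0" "Im w / 2 < Im w" using w by (auto simp: uhp_def)
    let ?K = "2 + 2 / (Im w / 2)"
    have K: "?K \<ge> 0" using r by simp
    have "cmod (F w) \<le> (cmod (\<psi> w - \<mu>) * A) ^ m * (?K * B)" for m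
    proof -
      let ?G = "(S ^^ m) F"
      have "Hnp_max_norm n p ?G \<le> ennreal (A ^ m * B)"
        using order.trans[OF Hnp_max_norm_le_Hnp_norm[OF p]] iter[of m] B A
        by (metis ennreal_mult' zero_le_one order.trans zero_le_power)
      then have "Hnp_max_real_norm n p ?G \<le> A ^ m * B"
        using A B by (intro Hnp_max_real_norm_le) auto
      then have "cmod (?G w) \<le> ?K * (A ^ m * B)"
        using cmod_le_Hnp_norm[OF p _ r, of ?G n] iter[of m] K by (meson mult_left_mono order.trans)
      then have "cmod (\<psi> w - \<mu>) ^ m * cmod (?G w) \<le> cmod (\<psi> w - \<mu>) ^ m * (?K * (A ^ m * B))"
        by (rule mult_left_mono) simp
      moreover have "cmod (F w) = cmod (\<psi> w - \<mu>) ^ m * cmod (?G w)"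
        using iter[of m] by (metis norm_mult norm_power)
      ultimately show ?thesis by (simp add: power_mult_distrib mult_ac)
    qed
    moreover have "(\<lambda>m. (cmod (\<psi> w - \<mu>) * A) ^ m * (?K * B)) \<longlonglongrightarrow> 0"
      using x A by (intro tendsto_mult_left_zero LIMSEQ_realpow_zero) auto
    ultimately have "cmod (F w) \<le> 0"
      by (intro LIMSEQ_le_const) auto
    then show False using F(2)[OF w] by simp
  qed
  have "\<exists>v\<in>\<psi> ` uhp. dist v \<mu> < 1 / A"
    using \<mu> A(1) unfolding closure_approachable by simp
  then obtain w where "w \<in> uhp" "dist (\<psi> w) \<mu> < 1 / A" by blast
  then show False using far[of w] by (simp add: dist_norm)
qed

lemma in_closure_if_in_spectrum:
  assumes p: "1 \<le> p" and \<psi>: "\<psi> \<in> multipliers n p"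
    and \<mu>: "\<mu> \<in> spectrum_on (Hnp n p) (Hnp_norm n p) (mult_op \<psi>)"
  shows "\<mu> \<in> closure (\<psi> ` uhp)"
proof (rule ccontr)
  assume "\<mu> \<notin> closure (\<psi> ` uhp)"
  then obtain \<delta> where \<delta>: "\<delta> > 0" "\<And>z. z \<in> uhp \<Longrightarrow> \<delta> \<le> cmod (\<psi> z - \<mu>)"
    by (auto simp: closure_approachable dist_norm not_less)
  define S where "S F z = F z / (\<psi> z - \<mu>)" for F z
  obtain K where K: "K \<ge> 0" "\<And>F. F \<in> Hnp n p \<Longrightarrow> S F \<in> Hnp n p"
    "\<And>F. F \<in> Hnp n p \<Longrightarrow> Hnp_max_norm n p (S F) \<le> ennreal K * Hnp_max_norm n p F"
    using Hnp_divide[OF p multipliers_diff_const[OF p \<psi>] \<delta>] unfolding S_def by metis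
  have bounded: "Hnp_norm n p (S F) \<le> ennreal (real (Suc n) * K) * Hnp_norm n p F"
    if F: "F \<in> Hnp n p" for F
  proof -
    have "Hnp_norm n p (S F) \<le> ennreal (real (Suc n)) * Hnp_max_norm n p (S F)"
      by (rule Hnp_norm_le_Hnp_max_norm[OF p])
    also have "\<dots> \<le> ennreal (real (Suc n)) * (ennreal K * Hnp_norm n p F)"
      using order.trans[OF K(3)[OF F] mult_left_mono[OF Hnp_max_norm_le_Hnp_norm[OF p]]]
      by (intro mult_left_mono) auto
    finally show ?thesis using K(1) by (simp add: ennreal_mult mult.assoc del: of_nat_Suc)
  qed
  have op: "bounded_operator_on (Hnp n p) (Hnp_norm n p) S"
    unfolding bounded_operator_on_def
  proof (intro conjI ballI allI exI)
    show "S (\<lambda>z. F z + G z) = (\<lambda>z. S F z + S G z)" for F G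
      by (simp add: S_def fun_eq_iff add_divide_distrib)
    show "S (\<lambda>z. c * F z) = (\<lambda>z. c * S F z)" for F c
      by (simp add: S_def fun_eq_iff)
  qed (use K(2) bounded in auto)
  have nz: "F z = 0 \<or> \<psi> z - \<mu> \<noteq> 0" if F: "F \<in> Hnp n p" for F z
    using \<delta>(1) \<delta>(2)[of z] F by (cases "z \<in> uhp") (auto simp: Hnp_iff)
  have "S (\<lambda>z. mult_op \<psi> F z - \<mu> * F z) = F" "(\<lambda>z. mult_op \<psi> (S F) z - \<mu> * S F z) = F"
    if F: "F \<in> Hnp n p" for F
  proof -
    show "S (\<lambda>z. mult_op \<psi> F z - \<mu> * F z) = F"
      unfolding S_def mult_op_def left_diff_distrib[symmetric] using nz[OF F] by fastforce
    show "(\<lambda>z. mult_op \<psi> (S F) z - \<mu> * S F z) = F"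
      unfolding S_def mult_op_def left_diff_distrib[symmetric] using nz[OF F] by fastforce
  qed
  then show False
    using \<mu> op unfolding spectrum_on_def by blast
qed

theorem theorem5p5:
  fixes p :: ennreal and n :: nat and \<psi> :: "complex \<Rightarrow> complex"
  assumes "1 \<le> p"
    and "\<psi> \<in> multipliers n p"
  shows "spectrum_on (Hnp n p) (Hnp_norm n p) (mult_op \<psi>) = closure (\<psi> ` uhp)"
  using in_spectrum_if_in_closure[OF assms] in_closure_if_in_spectrum[OF assms] by blast

end
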